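(* There is an absolute constant $C>0$ such that for every positive integer $k_1$, with $n=2k_1$, every unitary $U\in\mathrm{U}(2^n)$ on an $n$-qubit system divided into two sets $A$ and $B$ of $k_1$ qubits each (an equal bipartite system) can be implemented exactly by a circuit, without ancilla qubits, consisting of arbitrary unitaries within $A$, arbitrary unitaries within $B$, and at most $C\,4^{k_1}$ straddling gates. That is, any $n$-qubit unitary can be constructed with $O(4^{k_1})$ straddling gates.
   Context: A straddling gate is a two-qubit gate (any element of $\mathrm{SU}(4)$) acting on one qubit of $A$ and one qubit of $B$. Unitaries acting only on the qubits of $A$, or only on the qubits of $B$, are free and are not counted. *)

theory Defs
  imports "Jordan_Normal_Form.Schur_Decomposition"
begin

definition unitary_group :: "nat \<Rightarrow> complex mat set" where
  "unitary_group d = {U \<in> carrier_mat d d. mat_adjoint U * U = 1\<^sub>m d}"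

definition special_unitary_group :: "nat \<Rightarrow> complex mat set" where
  "special_unitary_group d = {U \<in> unitary_group d. det U = 1}"

text \<open>The qubits of an n-qubit system are numbered 0, ..., n - 1. The computational basis vector
  with index i < 2 ^ n is the one in which qubit r has the value \<^term>\<open>bit i r\<close>.
  A gate carries a list of m distinct qubits and a matrix of dimension 2 ^ m on these qubits;
  qubit number t of the list provides bit t of the row and column indices of this matrix.\<close>

datatype gate = Gate (gate_qubits: "nat list") (gate_matrix: "complex mat")

definition sub_index :: "nat list \<Rightarrow> nat \<Rightarrow> nat" where
  "sub_index qs i = horner_sum of_bool 2 (map (bit i) qs)"

text \<open>The matrix of a gate on the whole system, that is, its matrix tensored with the identity
  on all qubits that are not in its list.\<close>

definition gate_op :: "nat \<Rightarrow> gate \<Rightarrow> complex mat" where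
  "gate_op n g = mat (2 ^ n) (2 ^ n) (\<lambda>(i, j).
     if \<forall>r<n. r \<notin> set (gate_qubits g) \<longrightarrow> bit i r = bit j r
     then gate_matrix g $$ (sub_index (gate_qubits g) i, sub_index (gate_qubits g) j)
     else 0)"

definition local_gate :: "nat set \<Rightarrow> gate \<Rightarrow> bool" where
  "local_gate S g \<longleftrightarrow> distinct (gate_qubits g) \<and> set (gate_qubits g) \<subseteq> S \<and>
     gate_matrix g \<in> unitary_group (2 ^ length (gate_qubits g))"

definition straddling_gate :: "nat set \<Rightarrow> nat set \<Rightarrow> gate \<Rightarrow> bool" where
  "straddling_gate A B g \<longleftrightarrow>
     (\<exists>p\<in>A. \<exists>q\<in>B. gate_qubits g = [p, q] \<or> gate_qubits g = [q, p]) \<and>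
     gate_matrix g \<in> special_unitary_group 4"

definition bipartite_circuit :: "nat set \<Rightarrow> nat set \<Rightarrow> gate list \<Rightarrow> bool" where
  "bipartite_circuit A B c \<longleftrightarrow>
     (\<forall>g\<in>set c. local_gate A g \<or> local_gate B g \<or> straddling_gate A B g)"

definition straddling_count :: "nat set \<Rightarrow> nat set \<Rightarrow> gate list \<Rightarrow> nat" where
  "straddling_count A B c = length (filter (straddling_gate A B) c)"

text \<open>The first gate of the list is applied first, so it is the rightmost factor.\<close>

fun circuit_op :: "nat \<Rightarrow> gate list \<Rightarrow> complex mat" where
  "circuit_op n [] = 1\<^sub>m (2 ^ n)"
| "circuit_op n (g # c) = circuit_op n c * gate_op n g"

end

theory Submission
  imports Defs
begin

text \<open>Write \<open>d = 2 ^ k\<close>, so that the system is \<open>C^d \<otimes> C^d\<close>. A product of O(1) controlled-NOTs,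
  conjugated by local unitaries, gives any unitary \<open>W\<close> acting on B when A is in one fixed basis state:
  a diagonal matrix with conjugate pairs of entries is a product of two involutions of trace 0, its
  square can be confined to one basis state of A by a permutation of the basis of A, every diagonal
  matrix of determinant 1 is a product of two such matrices, and the remaining phase is local to A.
  Hence the operators that are block diagonal with respect to A cost O(d). The cosine-sine
  decomposition splits a unitary with blocks of size \<open>2m\<close> into two unitaries with blocks of size \<open>m\<close>
  and one factor that a unitary local to A makes diagonal. Doubling the size of the blocks from \<open>d\<close> to
  \<open>d * d\<close> therefore costs \<open>O(d) * (1 + 2 + ... + 2 ^ k) = O(4 ^ k)\<close>.\<close>

subsection \<open>Unitary and diagonal matrices\<close>

text \<open>The bound leaves only O(1) straddling gates for each of the \<open>d\<close> blocks of a
  block diagonal operator, although each block is an arbitrary unitary of dimension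
  \<open>d\<close>. This is possible because only the conjugacy class of a controlled operation
  matters: free unitaries on B turn the NOT on one qubit into any involution whose eigenvalues 1 and
  -1 are equally frequent. The obstacle lies in A: a controlled-NOT fires on half of the basis
  states of A, and no permutation of them changes that number. Hence the words in two involutions
  that collapse to the identity on every state of A but one. The recursion treats all blocks of one
  size together, so its cost does not depend on their number: \<open>T 0 = 16 * d\<close> and
  \<open>T (j + 1) = 2 * T j + 16 * d\<close>. Here 16 counts two diagonal factors of 8
  controlled-NOTs each, and summing the levels doubles it to the final constant 32. Since the qubits
  of A and B may be interleaved in any way, all of this is done in a basis numbering with A as the
  high digit, and only the last part translates to circuits.\<close>

declare index_mult_mat(1) [simp del]

lemma mat_adjoint_carrier [simp, intro]:
  "A \<in> carrier_mat n m \<Longrightarrow> mat_adjoint A \<in> carrier_mat m n"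
  by (auto simp: mat_adjoint_def)

lemma dim_mat_adjoint [simp]:
  "dim_row (mat_adjoint A) = dim_col A" "dim_col (mat_adjoint A) = dim_row A"
  by (auto simp: mat_adjoint_def)

lemma index_mat_adjoint [simp]:
  fixes A :: "complex mat"
  shows "i < dim_col A \<Longrightarrow> j < dim_row A \<Longrightarrow> mat_adjoint A $$ (i, j) = cnj (A $$ (j, i))"
  by (auto simp: mat_adjoint_def mat_of_rows_index)

lemma index_mult_mat_sum:
  assumes "A \<in> carrier_mat n k" "B \<in> carrier_mat k m" "i < n" "j < m"
  shows "(A * B) $$ (i, j) = (\<Sum>l<k. A $$ (i, l) * B $$ (l, j))"
  using assms by (auto simp: index_mult_mat(1) scalar_prod_def lessThan_atLeast0)

lemma mat_adjoint_mult:
  fixes A B :: "complex mat"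
  assumes "A \<in> carrier_mat n k" "B \<in> carrier_mat k m"
  shows "mat_adjoint (A * B) = mat_adjoint B * mat_adjoint A"
  by (rule eq_matI)
     (use assms in \<open>auto simp: index_mult_mat_sum[OF assms]
        index_mult_mat_sum[of "mat_adjoint B" m k "mat_adjoint A" n] mult.commute\<close>)

lemma mat_adjoint_adjoint [simp]: "mat_adjoint (mat_adjoint A) = (A :: complex mat)"
  by (rule eq_matI) auto

lemma mat_adjoint_one [simp]: "mat_adjoint (1\<^sub>m n) = (1\<^sub>m n :: complex mat)"
  by (rule eq_matI) auto

lemma unitary_carrier: "U \<in> unitary_group n \<Longrightarrow> U \<in> carrier_mat n n"
  by (simp add: unitary_group_def)

lemma unitary_adjoint_left: "U \<in> unitary_group n \<Longrightarrow> mat_adjoint U * U = 1\<^sub>m n"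
  by (simp add: unitary_group_def)

text \<open>A left inverse of a square matrix over a field is a right inverse; the definition
  supplies only the left equation.\<close>

lemma unitary_adjoint_right: "U \<in> unitary_group n \<Longrightarrow> U * mat_adjoint U = 1\<^sub>m n"
  by (rule mat_mult_left_right_inverse[of "mat_adjoint U" n U]) (auto simp: unitary_group_def)

lemma unitary_one [simp]: "1\<^sub>m n \<in> unitary_group n"
  by (simp add: unitary_group_def)

lemma unitary_adjoint: "U \<in> unitary_group n \<Longrightarrow> mat_adjoint U \<in> unitary_group n"
  using unitary_adjoint_right[of U n] by (auto simp: unitary_group_def)

lemma unitary_mult:
  assumes U: "U \<in> unitary_group n" and V: "V \<in> unitary_group n"
  shows "U * V \<in> unitary_group n"
proof -
  note c = unitary_carrier[OF U] unitary_carrier[OF V]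
  have "mat_adjoint (U * V) * (U * V) = mat_adjoint V * (mat_adjoint U * U) * V"
    using c by (simp add: mat_adjoint_mult[OF c] assoc_mult_mat[where ?n\<^sub>1.0 = n and ?n\<^sub>2.0 = n and ?n\<^sub>3.0 = n and ?n\<^sub>4.0 = n] mult_carrier_mat[of _ n n _ n])
  also have "\<dots> = 1\<^sub>m n"
    using c V by (simp add: unitary_adjoint_left[OF U] unitary_adjoint_left[OF V])
  finally show ?thesis using c by (auto simp: unitary_group_def)
qed

text \<open>The trailing factor \<open>A\<close> makes the cancellation applicable inside products
  that are bracketed to the right.\<close>

lemma mult_adjoint_cancel:
  assumes "U \<in> unitary_group n" "A \<in> carrier_mat n m"
  shows "U * (mat_adjoint U * A) = A" "mat_adjoint U * (U * A) = A"
  using assms unitary_carrier[OF assms(1)]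
  by (simp_all flip: assoc_mult_mat[of _ n n _ n _ m]
        add: unitary_adjoint_left unitary_adjoint_right)

lemma unitary_entries:
  "U \<in> unitary_group n \<longleftrightarrow> U \<in> carrier_mat n n \<and>
     (\<forall>i<n. \<forall>j<n. (\<Sum>k<n. cnj (U $$ (k, i)) * U $$ (k, j)) = (if i = j then 1 else 0))"
  (is "_ \<longleftrightarrow> _ \<and> ?P")
proof (cases "U \<in> carrier_mat n n")
  case True
  have "mat_adjoint U * U = 1\<^sub>m n \<longleftrightarrow>
      (\<forall>i<n. \<forall>j<n. (mat_adjoint U * U) $$ (i, j) = 1\<^sub>m n $$ (i, j))"
    using True by (auto intro!: eq_matI)
  also have "\<dots> \<longleftrightarrow> ?P"
    using True by (simp add: index_mult_mat_sum[of _ n n _ n])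
  finally show ?thesis using True by (simp add: unitary_group_def)
qed (simp add: unitary_group_def)

definition dg :: "nat \<Rightarrow> (nat \<Rightarrow> complex) \<Rightarrow> complex mat" where
  "dg n f = mat n n (\<lambda>(i, j). if i = j then f i else 0)"

lemma dg_carrier [simp, intro]: "dg n f \<in> carrier_mat n n"
  by (simp add: dg_def)

lemma dim_dg [simp]: "dim_row (dg n f) = n" "dim_col (dg n f) = n"
  by (simp_all add: dg_def)

lemma index_dg [simp]: "i < n \<Longrightarrow> j < n \<Longrightarrow> dg n f $$ (i, j) = (if i = j then f i else 0)"
  by (simp add: dg_def)

lemma dg_cong: "(\<And>i. i < n \<Longrightarrow> f i = g i) \<Longrightarrow> dg n f = dg n g"
  by (rule eq_matI) auto

lemma index_mult_dg:
  assumes "A \<in> carrier_mat m n" "i < m" "j < n"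
  shows "(A * dg n f) $$ (i, j) = A $$ (i, j) * f j"
proof -
  have "(A * dg n f) $$ (i, j) = (\<Sum>l<n. A $$ (i, l) * dg n f $$ (l, j))"
    by (rule index_mult_mat_sum) (use assms in auto)
  also have "\<dots> = (\<Sum>l<n. if l = j then A $$ (i, j) * f j else 0)"
    using assms by (intro sum.cong) auto
  finally show ?thesis using assms by simp
qed

lemma index_dg_mult:
  assumes "A \<in> carrier_mat n m" "i < n" "j < m"
  shows "(dg n f * A) $$ (i, j) = f i * A $$ (i, j)"
proof -
  have "(dg n f * A) $$ (i, j) = (\<Sum>l<n. dg n f $$ (i, l) * A $$ (l, j))"
    by (rule index_mult_mat_sum) (use assms in auto)
  also have "\<dots> = (\<Sum>l<n. if i = l then f i * A $$ (i, j) else 0)"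
    using assms by (intro sum.cong) auto
  finally show ?thesis using assms by simp
qed

lemma dg_mult: "dg n f * dg n g = dg n (\<lambda>i. f i * g i)"
  by (rule eq_matI) (auto simp: index_dg_mult[where n = n and m = n])

lemma dg_add: "dg n f + dg n g = dg n (\<lambda>i. f i + g i)"
  by (rule eq_matI) auto

lemma dg_one: "dg n (\<lambda>_. 1) = 1\<^sub>m n"
  by (rule eq_matI) auto

lemma dg_zero: "dg n (\<lambda>_. 0) = 0\<^sub>m n n"
  by (rule eq_matI) auto

lemma mat_adjoint_dg: "mat_adjoint (dg n f) = dg n (\<lambda>i. cnj (f i))"
  by (rule eq_matI) auto

lemma dg_unitary:
  assumes "\<And>i. i < n \<Longrightarrow> cmod (f i) = 1"
  shows "dg n f \<in> unitary_group n"
proof -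
  have "mat_adjoint (dg n f) * dg n f = dg n (\<lambda>i. cnj (f i) * f i)"
    by (simp add: mat_adjoint_dg dg_mult)
  also have "\<dots> = dg n (\<lambda>_. 1)"
    by (rule dg_cong) (use assms in \<open>simp add: mult.commute complex_norm_square[symmetric]\<close>)
  finally show ?thesis by (simp add: unitary_group_def dg_one)
qed

lemma dg_unitaryD:
  assumes "dg n f \<in> unitary_group n" "i < n"
  shows "cmod (f i) = 1"
proof -
  have "dg n (\<lambda>i. cnj (f i) * f i) $$ (i, i) = (1\<^sub>m n :: complex mat) $$ (i, i)"
    using unitary_adjoint_left[OF assms(1)] by (simp add: mat_adjoint_dg dg_mult)
  then have "f i * cnj (f i) = 1" using assms(2) by (simp add: mult.commute)
  then have "of_real ((cmod (f i))\<^sup>2) = (1 :: complex)" by (simp only: complex_norm_square)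
  then have "(cmod (f i))\<^sup>2 = 1" by (metis of_real_eq_1_iff)
  then show ?thesis by (simp add: abs_square_eq_1)
qed

subsection \<open>Diagonalization\<close>

definition vnorm :: "complex vec \<Rightarrow> real" where
  "vnorm v = sqrt (\<Sum>i<dim_vec v. (cmod (v $ i))\<^sup>2)"

lemma vnorm_sq: "complex_of_real ((vnorm v)\<^sup>2) = (\<Sum>i<dim_vec v. cnj (v $ i) * v $ i)"
  unfolding vnorm_def
  by (subst real_sqrt_pow2) (auto intro!: sum_nonneg sum.cong simp: mult.commute complex_norm_square simp del: of_real_power)

lemma vnorm_pos:
  assumes "v \<in> carrier_vec n" "v \<noteq> 0\<^sub>v n"
  shows "vnorm v > 0"
proof -
  obtain i where "i < n" "v $ i \<noteq> 0" using assms by (metis carrier_vecD eq_vecI index_zero_vec)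
  then have "0 < (\<Sum>i<n. (cmod (v $ i))\<^sup>2)"
    by (intro sum_pos2[of _ i]) auto
  then show ?thesis using assms(1) by (simp add: vnorm_def)
qed

text \<open>Gram-Schmidt, applied to a basis that starts with \<open>v\<close>, leaves its first
  vector unchanged; scaling the resulting orthogonal vectors to length 1 gives the columns of
  \<open>W\<close>.\<close>

lemma unitary_first_column:
  assumes v: "v \<in> carrier_vec n" "v \<noteq> 0\<^sub>v n"
  obtains W where "W \<in> unitary_group n" "\<And>i. i < n \<Longrightarrow> W $$ (i, 0) = v $ i / of_real (vnorm v)"
proof -
  interpret cof_vec_space n "TYPE(complex)" .
  note b = basis_completion[OF v]
  define ws where "ws = gram_schmidt n (basis_completion v)"
  note gs = gram_schmidt_result[OF b(2,4,5) ws_def]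
  have n: "n \<noteq> 0" using v by (metis carrier_vecD eq_vecI index_zero_vec(2) not_less0)
  have len: "length ws = n" using gs(4) b(6) by simp
  obtain vs where vs: "basis_completion v = v # vs"
    using b(6,7) n by (metis list.exhaust_sel list.size(3))
  have "ws \<noteq> []" using len n by auto
  then have hd: "ws ! 0 = v"
    using gram_schmidt_hd[OF v(1), of vs] unfolding ws_def vs by (metis hd_conv_nth)
  have wsc: "ws ! j \<in> carrier_vec n" if "j < n" for j
    using gs(3) len that by (metis nth_mem subsetD)
  have orth: "(ws ! i \<bullet>c ws ! j = 0) = (i \<noteq> j)" if "i < n" "j < n" for i j
    using corthogonalD[OF gs(2)] len that by simp
  define W where "W = mat n n (\<lambda>(i, j). ws ! j $ i / of_real (vnorm (ws ! j)))"
  have cp: "ws ! i \<bullet>c ws ! j = (\<Sum>k<n. ws ! i $ k * cnj (ws ! j $ k))" if "i < n" "j < n" for i j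
    using wsc[OF that(1)] wsc[OF that(2)] by (auto simp: scalar_prod_def lessThan_atLeast0)
  \<comment> \<open>\<open>orth\<close> is an equivalence, so for equal indices it says that no
    vector of \<open>ws\<close> is isotropic, in particular none is zero.\<close>
  have nz: "ws ! i \<noteq> 0\<^sub>v n" if "i < n" for i
    using orth[OF that that] cp[OF that that] that by auto
  have "W \<in> unitary_group n"
    unfolding unitary_entries
  proof (intro conjI allI impI)
    fix i j assume ij: "i < n" "j < n"
    have "(\<Sum>k<n. cnj (W $$ (k, i)) * W $$ (k, j)) =
        (\<Sum>k<n. ws ! j $ k * cnj (ws ! i $ k)) / (of_real (vnorm (ws ! i)) * of_real (vnorm (ws ! j)))"
      unfolding sum_divide_distrib by (intro sum.cong) (use ij in \<open>auto simp: W_def\<close>)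
    also have "\<dots> = (if i = j then 1 else 0)"
    proof (cases "i = j")
      case True
      have "(\<Sum>k<n. ws ! j $ k * cnj (ws ! i $ k)) = of_real ((vnorm (ws ! i))\<^sup>2)"
        using True carrier_vecD[OF wsc[OF ij(1)]] by (simp only: vnorm_sq mult.commute)
      then show ?thesis
        using True vnorm_pos[OF wsc[OF ij(1)] nz[OF ij(1)]] by (simp add: power2_eq_square)
    next
      case False
      then show ?thesis using orth[OF ij(2,1)] cp[OF ij(2,1)] by simp
    qed
    finally show "(\<Sum>k<n. cnj (W $$ (k, i)) * W $$ (k, j)) = (if i = j then 1 else 0)" .
  qed (simp add: W_def)
  moreover have "W $$ (i, 0) = v $ i / of_real (vnorm v)" if "i < n" for i
    using that n hd by (simp add: W_def)
  ultimately show ?thesis using that by blast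
qed

lemma complex_eigenvector:
  fixes A :: "complex mat"
  assumes A: "A \<in> carrier_mat n n" and "n > 0"
  obtains v e where "v \<in> carrier_vec n" "v \<noteq> 0\<^sub>v n" "A *\<^sub>v v = e \<cdot>\<^sub>v v"
proof -
  have "degree (char_poly A) = n" using degree_monic_char_poly[OF A] by simp
  then have "\<not> constant (poly (char_poly A))" using \<open>n > 0\<close> by (simp add: constant_degree)
  then obtain e where "poly (char_poly A) e = 0" using fundamental_theorem_of_algebra by blast
  then have "eigenvalue A e" using eigenvalue_root_char_poly[OF A] by blast
  then show ?thesis using that A by (auto simp: eigenvalue_def eigenvector_def)
qed

lemma mat_adjoint_four_block:
  fixes A B C D :: "complex mat"
  assumes "A \<in> carrier_mat p r" "B \<in> carrier_mat p s" "C \<in> carrier_mat q r" "D \<in> carrier_mat q s"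
  shows "mat_adjoint (four_block_mat A B C D) =
    four_block_mat (mat_adjoint A) (mat_adjoint C) (mat_adjoint B) (mat_adjoint D)"
  by (rule eq_matI) (use assms in auto)

lemma mat_adjoint_zero [simp]: "mat_adjoint (0\<^sub>m n m) = (0\<^sub>m m n :: complex mat)"
  by (rule eq_matI) auto

text \<open>Serves to read equations between blocks off a unitarity equation.\<close>

lemma four_block_mat_inject:
  assumes "A \<in> carrier_mat p r" "B \<in> carrier_mat p s" "C \<in> carrier_mat q r" "D \<in> carrier_mat q s"
    "A' \<in> carrier_mat p r" "B' \<in> carrier_mat p s" "C' \<in> carrier_mat q r" "D' \<in> carrier_mat q s"
    and eq: "four_block_mat A B C D = four_block_mat A' B' C' D'"
  shows "A = A' \<and> B = B' \<and> C = C' \<and> D = D'"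
proof -
  have e: "four_block_mat A B C D $$ (i, j) = four_block_mat A' B' C' D' $$ (i, j)" for i j
    by (simp only: eq)
  have "A $$ (i, j) = A' $$ (i, j)" if "i < p" "j < r" for i j
    using e[of i j] that assms(1-8) by simp
  moreover have "B $$ (i, j) = B' $$ (i, j)" if "i < p" "j < s" for i j
    using e[of i "r + j"] that assms(1-8) by simp
  moreover have "C $$ (i, j) = C' $$ (i, j)" if "i < q" "j < r" for i j
    using e[of "p + i" j] that assms(1-8) by simp
  moreover have "D $$ (i, j) = D' $$ (i, j)" if "i < q" "j < s" for i j
    using e[of "p + i" "r + j"] that assms(1-8) by simp
  ultimately show ?thesis using assms(1-8) by (auto intro!: eq_matI)
qed

section \<open>Direct sums of two square blocks\<close>

definition bdiag :: "complex mat \<Rightarrow> complex mat \<Rightarrow> complex mat" where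
  "bdiag A B = four_block_mat A (0\<^sub>m (dim_row A) (dim_col B)) (0\<^sub>m (dim_row B) (dim_col A)) B"

lemma dim_bdiag [simp]:
  "dim_row (bdiag A B) = dim_row A + dim_row B" "dim_col (bdiag A B) = dim_col A + dim_col B"
  by (auto simp: bdiag_def)

lemma index_bdiag:
  assumes "A \<in> carrier_mat p p" "B \<in> carrier_mat q q" "i < p + q" "j < p + q"
  shows "bdiag A B $$ (i, j) = (if i < p \<and> j < p then A $$ (i, j)
    else if i < p \<or> j < p then 0 else B $$ (i - p, j - p))"
  using assms by (auto simp: bdiag_def)

lemma bdiag_mult:
  assumes "A \<in> carrier_mat p p" "B \<in> carrier_mat q q" "C \<in> carrier_mat p p" "D \<in> carrier_mat q q"
  shows "bdiag A B * bdiag C D = bdiag (A * C) (B * D)"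
  using assms by (simp add: bdiag_def mult_four_block_mat[of _ p p _ q _ q _ _ p _ q])

lemma bdiag_carrier:
  "A \<in> carrier_mat p p \<Longrightarrow> B \<in> carrier_mat q q \<Longrightarrow> bdiag A B \<in> carrier_mat (p + q) (p + q)"
  by (auto simp: bdiag_def)

lemma mat_adjoint_bdiag:
  assumes "A \<in> carrier_mat p p" "B \<in> carrier_mat q q"
  shows "mat_adjoint (bdiag A B) = bdiag (mat_adjoint A) (mat_adjoint B)"
  using assms by (simp add: bdiag_def mat_adjoint_four_block[of _ p p _ q _ q])

lemma bdiag_one: "bdiag (1\<^sub>m p) (1\<^sub>m q) = 1\<^sub>m (p + q)"
  by (rule eq_matI) (auto simp: bdiag_def)

lemma bdiag_unitary_iff:
  assumes "A \<in> carrier_mat p p" "B \<in> carrier_mat q q"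
  shows "bdiag A B \<in> unitary_group (p + q) \<longleftrightarrow> A \<in> unitary_group p \<and> B \<in> unitary_group q"
proof -
  have "mat_adjoint (bdiag A B) * bdiag A B = bdiag (mat_adjoint A * A) (mat_adjoint B * B)"
    using assms by (simp only: mat_adjoint_bdiag[OF assms]
        bdiag_mult[OF mat_adjoint_carrier[OF assms(1)] mat_adjoint_carrier[OF assms(2)] assms])
  moreover have "bdiag (mat_adjoint A * A) (mat_adjoint B * B) = bdiag (1\<^sub>m p) (1\<^sub>m q) \<longleftrightarrow>
      mat_adjoint A * A = 1\<^sub>m p \<and> mat_adjoint B * B = 1\<^sub>m q"
  proof
    assume eq: "bdiag (mat_adjoint A * A) (mat_adjoint B * B) = bdiag (1\<^sub>m p) (1\<^sub>m q)"
    have "mat_adjoint A * A \<in> carrier_mat p p" "mat_adjoint B * B \<in> carrier_mat q q"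
      using assms by auto
    then show "mat_adjoint A * A = 1\<^sub>m p \<and> mat_adjoint B * B = 1\<^sub>m q"
      using four_block_mat_inject[of _ p p _ q _ q, OF _ _ _ _ _ _ _ _ eq[unfolded bdiag_def]] assms
      by simp
  qed auto
  ultimately show ?thesis
    using assms bdiag_carrier[OF assms] bdiag_one by (auto simp: unitary_group_def)
qed

lemma bdiag_dg:
  "bdiag (dg p f) (dg q g) = dg (p + q) (\<lambda>i. if i < p then f i else g (i - p))"
  by (rule eq_matI) (auto simp: index_bdiag[of _ p _ q])

text \<open>The inductive step shared by the spectral theorem and the singular value decomposition:
  with the first row and column cleared, a factorization of the remaining block \<open>N\<close>
  lifts to \<open>M\<close>. The former takes \<open>U = V\<close>, the latter needs two different
  unitaries. \<open>case_nat e f\<close> puts \<open>e\<close> in front of the diagonal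
  \<open>f\<close>.\<close>

lemma deflation:
  assumes M: "M \<in> carrier_mat (Suc m) (Suc m)"
    and U: "U \<in> unitary_group (Suc m)" and V: "V \<in> unitary_group (Suc m)"
    and col: "\<And>i. i < Suc m \<Longrightarrow> (mat_adjoint U * M * V) $$ (i, 0) = (if i = 0 then e else 0)"
    and row: "\<And>j. j < Suc m \<Longrightarrow> (mat_adjoint U * M * V) $$ (0, j) = (if j = 0 then e else 0)"
  obtains N where "N \<in> carrier_mat m m" "mat_adjoint U * M * V = bdiag (dg 1 (\<lambda>_. e)) N"
    "\<And>P R f. P \<in> unitary_group m \<Longrightarrow> R \<in> unitary_group m \<Longrightarrow> N = P * dg m f * mat_adjoint R \<Longrightarrow>
      M = (U * bdiag (1\<^sub>m 1) P) * dg (Suc m) (case_nat e f) * mat_adjoint (V * bdiag (1\<^sub>m 1) R)"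
proof -
  let ?n = "Suc m" and ?A = "mat_adjoint U * M * V"
  note c = M unitary_carrier[OF U] unitary_carrier[OF V]
  have Ac: "?A \<in> carrier_mat ?n ?n" using c by auto
  define N where "N = mat m m (\<lambda>(i, j). ?A $$ (Suc i, Suc j))"
  have Nc: "N \<in> carrier_mat m m" by (simp add: N_def)
  have AN: "?A = bdiag (dg 1 (\<lambda>_. e)) N"
  proof (rule eq_matI)
    fix i j assume "i < dim_row (bdiag (dg 1 (\<lambda>_. e)) N)" "j < dim_col (bdiag (dg 1 (\<lambda>_. e)) N)"
    then have "i < ?n" "j < ?n" using Nc by auto
    then show "?A $$ (i, j) = bdiag (dg 1 (\<lambda>_. e)) N $$ (i, j)"
      using Nc col[of i] row[of j] by (cases i; cases j) (auto simp: N_def bdiag_def)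
  qed (use Ac Nc in auto)
  have "M = (U * bdiag (1\<^sub>m 1) P) * dg ?n (case_nat e f) * mat_adjoint (V * bdiag (1\<^sub>m 1) R)"
    if PR: "P \<in> unitary_group m" "R \<in> unitary_group m" and N: "N = P * dg m f * mat_adjoint R" for P R f
  proof -
    note d = unitary_carrier[OF PR(1)] unitary_carrier[OF PR(2)]
    let ?P = "bdiag (1\<^sub>m 1) P" and ?R = "bdiag (1\<^sub>m 1) R" and ?D = "dg ?n (case_nat e f)"
    have PRc: "?P \<in> carrier_mat ?n ?n" "?R \<in> carrier_mat ?n ?n" using bdiag_carrier[of _ 1 _ m] d by auto
    have "?D = bdiag (dg 1 (\<lambda>_. e)) (dg m f)"
      unfolding bdiag_dg by (rule eq_matI) (auto split: nat.split)
    then have "?P * ?D * mat_adjoint ?R = bdiag (dg 1 (\<lambda>_. e)) N"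
      using d by (simp add: mat_adjoint_bdiag[of _ "Suc 0" _ m] bdiag_mult[of _ "Suc 0" _ m] N
          mult_carrier_mat[of _ m m])
    then have A: "?A = ?P * ?D * mat_adjoint ?R" using AN by simp
    have "M = U * (mat_adjoint U * (M * (V * mat_adjoint V)))"
      using c by (simp add: unitary_adjoint_right[OF V] mult_adjoint_cancel(1)[OF U])
    also have "\<dots> = U * ?A * mat_adjoint V"
      using c by (simp add: assoc_mult_mat[where ?n\<^sub>1.0 = ?n and ?n\<^sub>2.0 = ?n and ?n\<^sub>3.0 = ?n and ?n\<^sub>4.0 = ?n]
          mult_carrier_mat[of _ ?n ?n])
    also have "\<dots> = (U * ?P) * ?D * (mat_adjoint ?R * mat_adjoint V)"
      unfolding A using c PRc
      by (simp add: assoc_mult_mat[where ?n\<^sub>1.0 = ?n and ?n\<^sub>2.0 = ?n and ?n\<^sub>3.0 = ?n and ?n\<^sub>4.0 = ?n]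
          mult_carrier_mat[of _ ?n ?n])
    also have "mat_adjoint ?R * mat_adjoint V = mat_adjoint (V * ?R)"
      using mat_adjoint_mult[OF c(3) PRc(2)] by simp
    finally show ?thesis .
  qed
  with Nc AN show ?thesis using that by blast
qed

text \<open>An eigenvector as first column of \<open>V\<close> clears the first column of the
  conjugate of \<open>W\<close>, and unitarity then clears its first row.\<close>

lemma unitary_diagonalization:
  assumes "W \<in> unitary_group n"
  shows "\<exists>Q\<in>unitary_group n. \<exists>f. W = Q * dg n f * mat_adjoint Q"
  using assms
proof (induction n arbitrary: W)
  case 0
  then show ?case
    by (intro bexI[of _ "1\<^sub>m 0"] exI[of _ "\<lambda>_. 1"] eq_matI) (auto dest: unitary_carrier)
next
  case (Suc m W)
  let ?n = "Suc m"
  note Wc = unitary_carrier[OF Suc.prems]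
  obtain v e where v: "v \<in> carrier_vec ?n" "v \<noteq> 0\<^sub>v ?n" "W *\<^sub>v v = e \<cdot>\<^sub>v v"
    using complex_eigenvector[OF Wc] by blast
  obtain V where V: "V \<in> unitary_group ?n"
    and V0: "\<And>i. i < ?n \<Longrightarrow> V $$ (i, 0) = v $ i / of_real (vnorm v)"
    using unitary_first_column[OF v(1,2)] by blast
  note Vc = unitary_carrier[OF V]
  let ?A = "mat_adjoint V * W * V"
  have AU: "?A \<in> unitary_group ?n"
    by (intro unitary_mult unitary_adjoint V Suc.prems)
  note Ac = unitary_carrier[OF AU]
  have WV: "(W * V) $$ (i, 0) = e * V $$ (i, 0)" if "i < ?n" for i
  proof -
    have "(W * V) $$ (i, 0) = (\<Sum>l<?n. W $$ (i, l) * v $ l) / of_real (vnorm v)"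
      using that Wc Vc by (simp only: index_mult_mat_sum[OF Wc Vc that] sum_divide_distrib)
        (auto simp: V0 intro!: sum.cong)
    also have "(\<Sum>l<?n. W $$ (i, l) * v $ l) = (W *\<^sub>v v) $ i"
      using that Wc v(1) by (auto simp: scalar_prod_def lessThan_atLeast0)
    finally show ?thesis using that v(1) by (simp add: v(3) V0)
  qed
  have col: "?A $$ (i, 0) = (if i = 0 then e else 0)" if "i < ?n" for i
  proof -
    have "?A $$ (i, 0) = (mat_adjoint V * (W * V)) $$ (i, 0)"
      using Vc Wc by (simp add: assoc_mult_mat[of _ ?n ?n _ ?n _ ?n])
    also have "\<dots> = (\<Sum>k<?n. mat_adjoint V $$ (i, k) * (W * V) $$ (k, 0))"
      by (rule index_mult_mat_sum[of _ ?n]) (use that Vc Wc in auto)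
    also have "\<dots> = (\<Sum>k<?n. e * (cnj (V $$ (k, i)) * V $$ (k, 0)))"
      using that Vc by (intro sum.cong) (auto simp: WV)
    also have "\<dots> = e * (if i = 0 then 1 else 0)"
      using V that unfolding unitary_entries by (simp flip: sum_distrib_left)
    finally show ?thesis by auto
  qed
  \<comment> \<open>Column 0 of \<open>?A\<close> is \<open>e\<close> times a basis vector, so its
    inner product with column \<open>j\<close> is the single term with entry \<open>(0, j)\<close>.
    The case \<open>j = 0\<close> also yields \<open>e \<noteq> 0\<close>.\<close>
  have key: "cnj e * ?A $$ (0, j) = (if j = 0 then 1 else 0)" if "j < ?n" for j
  proof -
    have "(if 0 = j then 1 else 0) = (\<Sum>k<?n. cnj (?A $$ (k, 0)) * ?A $$ (k, j))"
      using AU that unfolding unitary_entries by auto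
    also have "\<dots> = (\<Sum>k<?n. if k = 0 then cnj e * ?A $$ (0, j) else 0)"
      by (intro sum.cong) (auto simp: col)
    finally show ?thesis by (auto split: if_splits)
  qed
  from key[of 0] col[of 0] have "e \<noteq> 0" by auto
  with key col[of 0] have row: "?A $$ (0, j) = (if j = 0 then e else 0)" if "j < ?n" for j
    using that by (metis complex_cnj_zero_iff mult_eq_0_iff zero_less_Suc)
  obtain N where N: "N \<in> carrier_mat m m" "?A = bdiag (dg 1 (\<lambda>_. e)) N"
    "\<And>P R f. P \<in> unitary_group m \<Longrightarrow> R \<in> unitary_group m \<Longrightarrow> N = P * dg m f * mat_adjoint R \<Longrightarrow>
      W = (V * bdiag (1\<^sub>m 1) P) * dg ?n (case_nat e f) * mat_adjoint (V * bdiag (1\<^sub>m 1) R)"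
    using deflation[OF Wc V V col row] by blast
  have "N \<in> unitary_group m"
    using AU bdiag_unitary_iff[of "dg 1 (\<lambda>_. e)" 1 N m] N(1,2) by simp
  from Suc.IH[OF this] obtain Q f where Q: "Q \<in> unitary_group m" "N = Q * dg m f * mat_adjoint Q"
    by blast
  have "V * bdiag (1\<^sub>m 1) Q \<in> unitary_group ?n"
    using bdiag_unitary_iff[of "1\<^sub>m 1" 1 Q m] Q(1) unitary_carrier[OF Q(1)]
    by (intro unitary_mult V) auto
  with N(3)[OF Q(1) Q(1) Q(2)] show ?case by blast
qed

text \<open>Deflation with different unitaries on the two sides. A singular \<open>M\<close> has
  kernel vectors on both sides, which split off the singular value 0. For an invertible
  \<open>M\<close> the first columns are an eigenvector of \<open>M* M\<close> and its normalized
  image under \<open>M\<close>.\<close>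

lemma singular_value_decomposition:
  assumes "M \<in> carrier_mat n n"
  shows "\<exists>P\<in>unitary_group n. \<exists>R\<in>unitary_group n. \<exists>s :: nat \<Rightarrow> real. (\<forall>i. s i \<ge> 0) \<and>
    M = P * dg n (\<lambda>i. of_real (s i)) * mat_adjoint R"
  using assms
proof (induction n arbitrary: M)
  case 0
  then show ?case
    by (intro bexI[of _ "1\<^sub>m 0"] exI[of _ "\<lambda>_. 1"] conjI eq_matI) auto
next
  case (Suc m M)
  let ?n = "Suc m"
  note Mc = Suc.prems
  have "\<exists>U\<in>unitary_group ?n. \<exists>V\<in>unitary_group ?n. \<exists>s::real. s \<ge> 0 \<and>
     (\<forall>i<?n. (mat_adjoint U * M * V) $$ (i, 0) = (if i = 0 then of_real s else 0)) \<and>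
     (\<forall>j<?n. (mat_adjoint U * M * V) $$ (0, j) = (if j = 0 then of_real s else 0))"
  proof (cases "det M = 0")
    case True
    then obtain v where v: "v \<in> carrier_vec ?n" "v \<noteq> 0\<^sub>v ?n" "M *\<^sub>v v = 0\<^sub>v ?n"
      using det_0_iff_vec_prod_zero_field[OF Mc] by blast
    have "det (transpose_mat M) = 0" using True det_transpose[OF Mc] by simp
    then obtain w where w: "w \<in> carrier_vec ?n" "w \<noteq> 0\<^sub>v ?n" "transpose_mat M *\<^sub>v w = 0\<^sub>v ?n"
      using det_0_iff_vec_prod_zero_field[of "transpose_mat M" ?n] Mc by auto
    \<comment> \<open>\<open>w\<close> is annihilated by the transpose, so its conjugate is
      annihilated by the adjoint of \<open>M\<close>.\<close>
    have w': "conjugate w \<in> carrier_vec ?n" "conjugate w \<noteq> 0\<^sub>v ?n"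
      using w(1,2) by (auto simp: conjugate_zero_iff_vec)
    obtain V where V: "V \<in> unitary_group ?n"
      and V0: "\<And>i. i < ?n \<Longrightarrow> V $$ (i, 0) = v $ i / of_real (vnorm v)"
      using unitary_first_column[OF v(1,2)] by blast
    obtain U where U: "U \<in> unitary_group ?n"
      and U0: "\<And>i. i < ?n \<Longrightarrow> U $$ (i, 0) = conjugate w $ i / of_real (vnorm (conjugate w))"
      using unitary_first_column[OF w'] by blast
    note c = unitary_carrier[OF U] unitary_carrier[OF V]
    have MV: "(M * V) $$ (i, 0) = 0" if "i < ?n" for i
    proof -
      have "(M * V) $$ (i, 0) = (\<Sum>l<?n. M $$ (i, l) * v $ l) / of_real (vnorm v)"
        using that Mc c by (simp only: index_mult_mat_sum[OF Mc c(2) that] sum_divide_distrib)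
          (auto simp: V0 intro!: sum.cong)
      also have "(\<Sum>l<?n. M $$ (i, l) * v $ l) = (M *\<^sub>v v) $ i"
        using that Mc v(1) by (auto simp: scalar_prod_def lessThan_atLeast0)
      finally show ?thesis using that by (simp add: v(3))
    qed
    have UM: "(mat_adjoint U * M) $$ (0, j) = 0" if "j < ?n" for j
    proof -
      have "(mat_adjoint U * M) $$ (0, j) =
          (\<Sum>l<?n. M $$ (l, j) * w $ l) / of_real (vnorm (conjugate w))"
        unfolding index_mult_mat_sum[OF mat_adjoint_carrier[OF c(1)] Mc zero_less_Suc that] sum_divide_distrib
        by (intro sum.cong refl) (use that c w(1) in \<open>simp add: U0\<close>)
      also have "(\<Sum>l<?n. M $$ (l, j) * w $ l) = (transpose_mat M *\<^sub>v w) $ j"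
        using that Mc w(1) by (auto simp: scalar_prod_def lessThan_atLeast0)
      finally show ?thesis using that by (simp add: w(3))
    qed
    have "(mat_adjoint U * M * V) $$ (i, 0) = 0" if "i < ?n" for i
    proof -
      have "(mat_adjoint U * M * V) $$ (i, 0) = (mat_adjoint U * (M * V)) $$ (i, 0)"
        using Mc c by (simp add: assoc_mult_mat[of _ ?n ?n _ ?n _ ?n])
      also have "\<dots> = (\<Sum>k<?n. mat_adjoint U $$ (i, k) * (M * V) $$ (k, 0))"
        by (rule index_mult_mat_sum[of _ ?n]) (use that Mc c in auto)
      finally show ?thesis by (simp add: MV)
    qed
    moreover have "(mat_adjoint U * M * V) $$ (0, j) = 0" if "j < ?n" for j
    proof -
      have "(mat_adjoint U * M * V) $$ (0, j) = (\<Sum>k<?n. (mat_adjoint U * M) $$ (0, k) * V $$ (k, j))"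
        by (rule index_mult_mat_sum[of _ ?n]) (use that Mc c in auto)
      then show ?thesis by (simp add: UM)
    qed
    ultimately show ?thesis using U V by (intro bexI[of _ U] bexI[of _ V] exI[of _ 0]) auto
  next
    case False
    let ?G = "mat_adjoint M * M"
    have Gc: "?G \<in> carrier_mat ?n ?n" using Mc by auto
    obtain v e where v: "v \<in> carrier_vec ?n" "v \<noteq> 0\<^sub>v ?n" "?G *\<^sub>v v = e \<cdot>\<^sub>v v"
      using complex_eigenvector[OF Gc] by blast
    obtain V where V: "V \<in> unitary_group ?n"
      and V0: "\<And>i. i < ?n \<Longrightarrow> V $$ (i, 0) = v $ i / of_real (vnorm v)"
      using unitary_first_column[OF v(1,2)] by blast
    note Vc = unitary_carrier[OF V]
    have Nc: "M * V \<in> carrier_mat ?n ?n" using Mc Vc by auto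
    have GV: "(?G * V) $$ (i, 0) = e * V $$ (i, 0)" if "i < ?n" for i
    proof -
      have "(?G * V) $$ (i, 0) = (\<Sum>l<?n. ?G $$ (i, l) * v $ l) / of_real (vnorm v)"
        using that by (simp only: index_mult_mat_sum[OF Gc Vc that] sum_divide_distrib)
          (auto simp: V0 intro!: sum.cong)
      also have "(\<Sum>l<?n. ?G $$ (i, l) * v $ l) = (?G *\<^sub>v v) $ i"
        using that Mc v(1) by (auto simp: scalar_prod_def lessThan_atLeast0)
      finally show ?thesis using that v(1) by (simp add: v(3) V0)
    qed
    \<comment> \<open>Since \<open>v\<close> is an eigenvector of \<open>?G\<close>, the columns of
      \<open>M * V\<close> inherit from those of \<open>V\<close> the orthogonality to column 0.
      This will clear the first row.\<close>
    have orth: "(\<Sum>k<?n. cnj ((M * V) $$ (k, j)) * (M * V) $$ (k, 0)) = (if j = 0 then e else 0)"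
      if j: "j < ?n" for j
    proof -
      have "(\<Sum>k<?n. cnj ((M * V) $$ (k, j)) * (M * V) $$ (k, 0)) =
          (mat_adjoint (M * V) * (M * V)) $$ (j, 0)"
        using j Mc Vc by (simp add: index_mult_mat_sum[OF mat_adjoint_carrier[OF Nc] Nc])
      also have "mat_adjoint (M * V) * (M * V) = mat_adjoint V * (?G * V)"
        using Mc Vc by (simp add: mat_adjoint_mult[OF Mc Vc] mult_carrier_mat[of _ ?n ?n]
            assoc_mult_mat[where ?n\<^sub>1.0 = ?n and ?n\<^sub>2.0 = ?n and ?n\<^sub>3.0 = ?n and ?n\<^sub>4.0 = ?n])
      also have "\<dots> $$ (j, 0) = (\<Sum>k<?n. mat_adjoint V $$ (j, k) * (?G * V) $$ (k, 0))"
        by (rule index_mult_mat_sum[of _ ?n]) (use j Mc Vc in auto)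
      also have "\<dots> = (\<Sum>k<?n. e * (cnj (V $$ (k, j)) * V $$ (k, 0)))"
        using j Vc by (intro sum.cong) (auto simp: GV)
      also have "\<dots> = e * (if j = 0 then 1 else 0)"
        using V j unfolding unitary_entries by (simp flip: sum_distrib_left)
      finally show ?thesis by auto
    qed
    define x where "x = col (M * V) 0"
    have xi: "x $ i = (M * V) $$ (i, 0)" if "i < ?n" for i
      using that Mc Vc by (simp add: x_def index_mult_mat(1))
    have xc: "x \<in> carrier_vec ?n" unfolding x_def by (rule col_carrier_vec[OF _ Nc]) simp
    \<comment> \<open>Invertibility of \<open>M\<close> guarantees that the image of the first
      column of \<open>V\<close> can be normalized.\<close>
    have "x \<noteq> 0\<^sub>v ?n"
    proof
      assume "x = 0\<^sub>v ?n"
      then have "M *\<^sub>v col V 0 = 0\<^sub>v ?n" unfolding x_def col_mult2[OF Mc Vc zero_less_Suc] .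
      moreover have "col V 0 \<noteq> 0\<^sub>v ?n"
      proof
        assume z: "col V 0 = 0\<^sub>v ?n"
        have "V $$ (k, 0) = 0" if "k < ?n" for k
          using arg_cong[OF z, of "\<lambda>u. u $ k"] that Vc by simp
        moreover have "(\<Sum>k<?n. cnj (V $$ (k, 0)) * V $$ (k, 0)) = 1"
          using V unfolding unitary_entries by auto
        ultimately show False by simp
      qed
      ultimately show False using det_0_iff_vec_prod_zero_field[OF Mc] False col_carrier_vec[OF zero_less_Suc Vc] by blast
    qed
    note xpos = vnorm_pos[OF xc this]
    obtain U where U: "U \<in> unitary_group ?n"
      and U0: "\<And>i. i < ?n \<Longrightarrow> U $$ (i, 0) = x $ i / of_real (vnorm x)"
      using unitary_first_column[OF xc \<open>x \<noteq> _\<close>] by blast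
    note Uc = unitary_carrier[OF U]
    have A: "(mat_adjoint U * M * V) $$ (i, j) = (\<Sum>k<?n. cnj (U $$ (k, i)) * (M * V) $$ (k, j))"
      if "i < ?n" "j < ?n" for i j
    proof -
      have "(mat_adjoint U * M * V) $$ (i, j) = (mat_adjoint U * (M * V)) $$ (i, j)"
        using Mc Uc Vc by (simp add: assoc_mult_mat[of _ ?n ?n _ ?n _ ?n])
      also have "\<dots> = (\<Sum>k<?n. mat_adjoint U $$ (i, k) * (M * V) $$ (k, j))"
        by (rule index_mult_mat_sum[of _ ?n]) (use that Mc Uc Vc in auto)
      finally show ?thesis using Uc that by simp
    qed
    have col: "(mat_adjoint U * M * V) $$ (i, 0) = (if i = 0 then of_real (vnorm x) else 0)"
      if i: "i < ?n" for i
    proof -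
      have "(mat_adjoint U * M * V) $$ (i, 0) = (\<Sum>k<?n. of_real (vnorm x) * (cnj (U $$ (k, i)) * U $$ (k, 0)))"
        unfolding A[OF i zero_less_Suc] by (intro sum.cong refl) (use xpos in \<open>simp add: U0 xi\<close>)
      also have "\<dots> = of_real (vnorm x) * (if i = 0 then 1 else 0)"
        using U i unfolding unitary_entries by (simp flip: sum_distrib_left)
      finally show ?thesis by auto
    qed
    have row: "(mat_adjoint U * M * V) $$ (0, j) = (if j = 0 then of_real (vnorm x) else 0)"
      if j: "j < ?n" for j
    proof (cases "j = 0")
      case False
      have "(mat_adjoint U * M * V) $$ (0, j) =
          (\<Sum>k<?n. cnj ((M * V) $$ (k, 0)) * (M * V) $$ (k, j)) / of_real (vnorm x)"
        unfolding A[OF zero_less_Suc j] sum_divide_distrib by (intro sum.cong refl) (simp add: U0 xi)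
      also have "(\<Sum>k<?n. cnj ((M * V) $$ (k, 0)) * (M * V) $$ (k, j)) =
          cnj (\<Sum>k<?n. cnj ((M * V) $$ (k, j)) * (M * V) $$ (k, 0))"
        unfolding cnj_sum by (intro sum.cong refl) simp
      also have "\<dots> = 0" using orth[OF j] False by simp
      finally show ?thesis using False by simp
    qed (use col[of 0] in simp)
    show ?thesis
      using U V col row xpos by (intro bexI[of _ U] bexI[of _ V] exI[of _ "vnorm x"]) auto
  qed
  then obtain U V s where U: "U \<in> unitary_group ?n" and V: "V \<in> unitary_group ?n" and s: "s \<ge> 0"
    and col: "\<And>i. i < ?n \<Longrightarrow> (mat_adjoint U * M * V) $$ (i, 0) = (if i = 0 then of_real s else 0)"
    and row: "\<And>j. j < ?n \<Longrightarrow> (mat_adjoint U * M * V) $$ (0, j) = (if j = 0 then of_real s else 0)"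
    by blast
  obtain N where N: "N \<in> carrier_mat m m" "mat_adjoint U * M * V = bdiag (dg 1 (\<lambda>_. of_real s)) N"
    "\<And>P R f. P \<in> unitary_group m \<Longrightarrow> R \<in> unitary_group m \<Longrightarrow> N = P * dg m f * mat_adjoint R \<Longrightarrow>
      M = (U * bdiag (1\<^sub>m 1) P) * dg ?n (case_nat (of_real s) f) * mat_adjoint (V * bdiag (1\<^sub>m 1) R)"
    using deflation[OF Mc U V col row] by blast
  from Suc.IH[OF N(1)] obtain P R t where PR: "P \<in> unitary_group m" "R \<in> unitary_group m"
    and t: "\<forall>i. t i \<ge> 0" "N = P * dg m (\<lambda>i. of_real (t i)) * mat_adjoint R"
    by blast
  have "case_nat (of_real s) (\<lambda>i. of_real (t i)) = (\<lambda>i. complex_of_real (case_nat s t i))"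
    by (auto split: nat.split)
  then have eq: "M = (U * bdiag (1\<^sub>m 1) P) * dg ?n (\<lambda>i. of_real (case_nat s t i)) *
      mat_adjoint (V * bdiag (1\<^sub>m 1) R)"
    using N(3)[OF PR t(2)] by simp
  have unit: "T * bdiag (1\<^sub>m 1) Q \<in> unitary_group ?n"
    if "Q \<in> unitary_group m" "T \<in> unitary_group ?n" for Q T
    using bdiag_unitary_iff[of "1\<^sub>m 1" 1 Q m] unitary_carrier[OF that(1)] that
    by (intro unitary_mult) auto
  have "\<forall>i. case_nat s t i \<ge> 0" using s t(1) by (auto split: nat.split)
  then show ?case
    by (intro bexI[OF _ unit[OF PR(1) U]] bexI[OF _ unit[OF PR(2) V]]
        exI[of _ "case_nat s t"] conjI eq)
qed

text \<open>\<^term>\<open>M\<close> need not be invertible: since positive square roots are unique, the positive factor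
  obtained from the singular value decomposition is the prescribed one.\<close>

lemma polar_diagonal:
  fixes s :: "nat \<Rightarrow> real"
  assumes M: "M \<in> carrier_mat n n" and s: "\<And>i. i < n \<Longrightarrow> s i \<ge> 0"
    and MM: "mat_adjoint M * M = dg n (\<lambda>i. of_real ((s i)\<^sup>2))"
  obtains V where "V \<in> unitary_group n" "M = V * dg n (\<lambda>i. of_real (s i))"
proof -
  obtain P R t where P: "P \<in> unitary_group n" and R: "R \<in> unitary_group n" and t: "\<forall>i. t i \<ge> 0"
    and svd: "M = P * dg n (\<lambda>i. of_real (t i)) * mat_adjoint R"
    using singular_value_decomposition[OF M] by blast
  let ?T = "dg n (\<lambda>i. of_real (t i))" and ?S = "dg n (\<lambda>i. of_real (s i))"
  note c = unitary_carrier[OF P] unitary_carrier[OF R]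
  note simps = assoc_mult_mat[where ?n\<^sub>1.0 = n and ?n\<^sub>2.0 = n and ?n\<^sub>3.0 = n and ?n\<^sub>4.0 = n]
    mult_carrier_mat[of _ n n]
  have adj: "mat_adjoint M = R * (?T * mat_adjoint P)"
    using c by (simp add: svd mat_adjoint_mult[of _ n n _ n] mat_adjoint_dg simps)
  have sq: "dg n (\<lambda>i. of_real ((s i)\<^sup>2)) * R = R * dg n (\<lambda>i. of_real ((t i)\<^sup>2))"
  proof -
    have "dg n (\<lambda>i. of_real ((s i)\<^sup>2)) * R = R * (?T * (mat_adjoint P * (P * (?T * (mat_adjoint R * R)))))"
      unfolding MM[symmetric] adj using c by (simp add: svd simps)
    also have "\<dots> = R * (?T * ?T)"
      using c by (simp add: unitary_adjoint_left[OF R] mult_adjoint_cancel(2)[OF P dg_carrier])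
    finally show ?thesis by (simp add: dg_mult power2_eq_square)
  qed
  \<comment> \<open>An entry of \<open>R\<close> can be nonzero only where \<open>s i\<close> and
    \<open>t j\<close> have equal squares, hence are equal. So \<open>R\<close> intertwines
    \<open>?S\<close> and \<open>?T\<close> just as it intertwines their squares.\<close>
  have "?S * R = R * ?T"
  proof (rule eq_matI)
    fix i j assume "i < dim_row (R * ?T)" "j < dim_col (R * ?T)"
    then have ij: "i < n" "j < n" using c by auto
    have "of_real ((s i)\<^sup>2) * R $$ (i, j) = R $$ (i, j) * of_real ((t j)\<^sup>2)"
      using arg_cong[OF sq, of "\<lambda>X. X $$ (i, j)"] ij c
      by (simp add: index_dg_mult[of _ n n] index_mult_dg[of _ n n])
    then have "R $$ (i, j) = 0 \<or> (s i)\<^sup>2 = (t j)\<^sup>2"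
      by (metis mult.commute mult_cancel_left of_real_eq_iff)
    then have "R $$ (i, j) = 0 \<or> s i = t j"
      using s[OF ij(1)] t by (simp add: power2_eq_iff_nonneg)
    then show "(?S * R) $$ (i, j) = (R * ?T) $$ (i, j)"
      using ij c by (auto simp: index_dg_mult[of _ n n] index_mult_dg[of _ n n])
  qed (use c in auto)
  then have SR: "R * ?T = ?S * R" by simp
  have "?T * mat_adjoint R = mat_adjoint R * (R * ?T) * mat_adjoint R"
    using c by (simp add: simps mult_adjoint_cancel(2)[OF R, of _ n])
  also have "\<dots> = mat_adjoint R * ?S"
    unfolding SR using c by (simp add: simps unitary_adjoint_right[OF R])
  finally have "?T * mat_adjoint R = mat_adjoint R * ?S" .
  then have "M = (P * mat_adjoint R) * ?S" using c by (simp add: svd simps)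
  then show ?thesis using that[OF unitary_mult[OF P unitary_adjoint[OF R]]] by blast
qed

subsection \<open>Cosine-sine decomposition\<close>

text \<open>The scalar \<open>- \<i>\<close> is absorbed by the unitary factor, so that the diagonal
  factor matches the lower left block of \<open>cs_mat\<close>.\<close>

lemma polar_diagonal_imaginary:
  fixes s :: "nat \<Rightarrow> real"
  assumes "M \<in> carrier_mat n n" "\<And>i. i < n \<Longrightarrow> s i \<ge> 0"
    and "mat_adjoint M * M = dg n (\<lambda>i. of_real ((s i)\<^sup>2))"
  obtains V where "V \<in> unitary_group n" "M = V * dg n (\<lambda>i. \<i> * of_real (s i))"
proof -
  obtain V where V: "V \<in> unitary_group n" "M = V * dg n (\<lambda>i. of_real (s i))"
    using polar_diagonal assms by blast
  have "V * dg n (\<lambda>_. - \<i>) \<in> unitary_group n"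
    by (intro unitary_mult V dg_unitary) simp
  moreover have "M = V * dg n (\<lambda>_. - \<i>) * dg n (\<lambda>i. \<i> * of_real (s i))"
    using unitary_carrier[OF V(1)] V(2)
    by (simp add: assoc_mult_mat[of _ n n _ n _ n] dg_mult mult.assoc[symmetric])
  ultimately show ?thesis using that by blast
qed

text \<open>Diagonal entries of \<open>M* M\<close> are squared column norms. This shows that the
  cosines are at most 1 before the sines are defined as square roots.\<close>

lemma adjoint_mult_diag_nonneg:
  assumes "M \<in> carrier_mat n m" "mat_adjoint M * M = dg m (\<lambda>i. complex_of_real (f i))" "i < m"
  shows "f i \<ge> 0"
proof -
  have "of_real (f i) = (mat_adjoint M * M) $$ (i, i)" using assms by simp
  also have "\<dots> = (\<Sum>k<n. mat_adjoint M $$ (i, k) * M $$ (k, i))"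
    by (rule index_mult_mat_sum) (use assms(1,3) in auto)
  also have "\<dots> = (\<Sum>k<n. of_real ((cmod (M $$ (k, i)))\<^sup>2))"
    by (intro sum.cong) (use assms(1,3) in \<open>auto simp: complex_norm_square mult.commute simp del: of_real_power\<close>)
  also have "\<dots> = of_real (\<Sum>k<n. (cmod (M $$ (k, i)))\<^sup>2)" by simp
  finally have "f i = (\<Sum>k<n. (cmod (M $$ (k, i)))\<^sup>2)" by (simp only: of_real_eq_iff)
  then show ?thesis by (simp add: sum_nonneg)
qed

text \<open>The off-diagonal blocks carry a factor \<open>\<i>\<close>, so that the matrix is symmetric and conjugate by a
  Hadamard matrix to a diagonal one with entries \<open>c \<plusminus> \<i> s\<close>.\<close>

definition cs_mat :: "nat \<Rightarrow> (nat \<Rightarrow> real) \<Rightarrow> (nat \<Rightarrow> real) \<Rightarrow> complex mat" where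
  "cs_mat m c s = four_block_mat (dg m (\<lambda>i. of_real (c i))) (dg m (\<lambda>i. \<i> * of_real (s i)))
     (dg m (\<lambda>i. \<i> * of_real (s i))) (dg m (\<lambda>i. of_real (c i)))"

lemma cs_mat_unitary:
  assumes "\<And>i. i < m \<Longrightarrow> (c i)\<^sup>2 + (s i)\<^sup>2 = 1"
  shows "cs_mat m c s \<in> unitary_group (m + m)"
proof -
  have "mat_adjoint (cs_mat m c s) * cs_mat m c s =
     four_block_mat (dg m (\<lambda>i. of_real ((c i)\<^sup>2 + (s i)\<^sup>2))) (dg m (\<lambda>_. 0))
       (dg m (\<lambda>_. 0)) (dg m (\<lambda>i. of_real ((c i)\<^sup>2 + (s i)\<^sup>2)))"
    unfolding cs_mat_def
    by (simp add: mat_adjoint_four_block[of _ m m _ m _ m] mat_adjoint_dg dg_mult dg_add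
        mult_four_block_mat[of _ m m _ m _ m _ _ m _ m])
      (intro arg_cong4[where f = four_block_mat] dg_cong; simp add: power2_eq_square algebra_simps)
  also have "dg m (\<lambda>i. of_real ((c i)\<^sup>2 + (s i)\<^sup>2)) = dg m (\<lambda>_. 1)"
    by (rule dg_cong) (simp only: assms of_real_1)
  finally show ?thesis
    by (auto simp: unitary_group_def cs_mat_def dg_one dg_zero intro!: eq_matI)
qed

text \<open>The singular values of the upper left block are the cosines. Normalization of rows and
  columns fixes the Gram matrices of the two neighbouring blocks, and polar decomposition turns both
  into \<open>\<i>\<close> times the sines. The fourth block need not be computed: after division by
  \<open>cs_mat\<close>, unitarity leaves it no freedom but a unitary on the second summand.\<close>

lemma cosine_sine_decomposition:
  assumes U: "U \<in> unitary_group (m + m)"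
  obtains L1 L2 R1 R2 c s where
    "L1 \<in> unitary_group m" "L2 \<in> unitary_group m" "R1 \<in> unitary_group m" "R2 \<in> unitary_group m"
    "\<And>i. i < m \<Longrightarrow> (c i)\<^sup>2 + (s i)\<^sup>2 = (1::real)"
    "U = bdiag L1 L2 * cs_mat m c s * bdiag R1 R2"
proof -
  obtain X Y Z W where split: "split_block U m m = (X, Y, Z, W)"
    by (metis prod_cases4)
  note sb = split_block[OF split, of m m]
  have Ud: "dim_row U = m + m" "dim_col U = m + m" using unitary_carrier[OF U] by auto
  note blocks = sb(1-4)[OF Ud] and Ueq = sb(5)[OF Ud]
  obtain P R c where P: "P \<in> unitary_group m" and R: "R \<in> unitary_group m"
    and c: "\<forall>i. c i \<ge> 0" and X: "X = P * dg m (\<lambda>i. of_real (c i)) * mat_adjoint R"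
    using singular_value_decomposition[OF blocks(1)] by blast
  note PRc = unitary_carrier[OF P] unitary_carrier[OF R]
  let ?C = "dg m (\<lambda>i. of_real (c i))"
  define U1 where "U1 = bdiag (mat_adjoint P) (1\<^sub>m m) * U * bdiag R (1\<^sub>m m)"
  have U1u: "U1 \<in> unitary_group (m + m)"
    unfolding U1_def using bdiag_unitary_iff[of _ m _ m] PRc P R unitary_adjoint[OF P]
    by (intro unitary_mult U) auto
  define Y1 where "Y1 = mat_adjoint P * Y"
  define Z1 where "Z1 = Z * R"
  have YZc: "Y1 \<in> carrier_mat m m" "Z1 \<in> carrier_mat m m"
    using PRc blocks by (auto simp: Y1_def Z1_def)
  have "mat_adjoint P * X * R = ?C"
    using PRc by (simp add: X mult_carrier_mat[of _ m m] unitary_adjoint_left[OF R]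
        mult_adjoint_cancel(2)[OF P dg_carrier] assoc_mult_mat[where ?n\<^sub>1.0 = m and ?n\<^sub>2.0 = m and ?n\<^sub>3.0 = m and ?n\<^sub>4.0 = m])
  then have U1: "U1 = four_block_mat ?C Y1 Z1 W"
    unfolding U1_def bdiag_def Ueq using PRc blocks
    by (simp add: mult_four_block_mat[of _ m m _ m _ m _ _ m _ m] mult_carrier_mat[of _ m m] Y1_def Z1_def)
  have one: "1\<^sub>m (m + m) = four_block_mat (1\<^sub>m m) (0\<^sub>m m m) (0\<^sub>m m m) (1\<^sub>m m :: complex mat)"
    by (rule eq_matI) auto
  have CC: "mat_adjoint ?C = ?C" by (simp add: mat_adjoint_dg)
  \<comment> \<open>The upper left block of \<open>U1* U1 = 1\<close> controls \<open>Z1\<close>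
    below \<open>?C\<close>; that of \<open>U1 U1* = 1\<close>, used next, controls
    \<open>Y1\<close> beside it.\<close>
  have "four_block_mat (?C * ?C + mat_adjoint Z1 * Z1) (?C * Y1 + mat_adjoint Z1 * W)
      (mat_adjoint Y1 * ?C + mat_adjoint W * Z1) (mat_adjoint Y1 * Y1 + mat_adjoint W * W) =
      four_block_mat (1\<^sub>m m) (0\<^sub>m m m) (0\<^sub>m m m) (1\<^sub>m m)"
    using unitary_adjoint_left[OF U1u] blocks YZc unfolding U1 one
    by (simp add: mat_adjoint_four_block[of _ m m _ m _ m] CC
        mult_four_block_mat[of _ m m _ m _ m _ _ m _ m])
  then have 1: "?C * ?C + mat_adjoint Z1 * Z1 = 1\<^sub>m m"
    by (rule four_block_mat_inject[of _ m m _ m _ m, THEN conjunct1, rotated 8])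
      (use blocks YZc in \<open>auto intro!: mult_carrier_mat add_carrier_mat\<close>)
  have "four_block_mat (?C * ?C + Y1 * mat_adjoint Y1) (?C * mat_adjoint Z1 + Y1 * mat_adjoint W)
      (Z1 * ?C + W * mat_adjoint Y1) (Z1 * mat_adjoint Z1 + W * mat_adjoint W) =
      four_block_mat (1\<^sub>m m) (0\<^sub>m m m) (0\<^sub>m m m) (1\<^sub>m m)"
    using unitary_adjoint_right[OF U1u] blocks YZc unfolding U1 one
    by (simp add: mat_adjoint_four_block[of _ m m _ m _ m] CC
        mult_four_block_mat[of _ m m _ m _ m _ _ m _ m])
  then have 2: "?C * ?C + Y1 * mat_adjoint Y1 = 1\<^sub>m m"
    by (rule four_block_mat_inject[of _ m m _ m _ m, THEN conjunct1, rotated 8])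
      (use blocks YZc in \<open>auto intro!: mult_carrier_mat add_carrier_mat\<close>)
  have compl: "N = dg m (\<lambda>i. of_real (1 - (c i)\<^sup>2))"
    if "?C * ?C + N = 1\<^sub>m m" "N \<in> carrier_mat m m" for N
  proof (rule eq_matI)
    fix i j assume "i < dim_row (dg m (\<lambda>i. complex_of_real (1 - (c i)\<^sup>2)))" "j < dim_col (dg m (\<lambda>i. complex_of_real (1 - (c i)\<^sup>2)))"
    then show "N $$ (i, j) = dg m (\<lambda>i. of_real (1 - (c i)\<^sup>2)) $$ (i, j)"
      using arg_cong[OF that(1), of "\<lambda>X. X $$ (i, j)"] that(2)
      by (auto simp: dg_mult power2_eq_square algebra_simps split: if_splits)
  qed (use that in auto)
  define s where "s i = sqrt (1 - (c i)\<^sup>2)" for i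
  have ZZ: "mat_adjoint Z1 * Z1 = dg m (\<lambda>i. of_real (1 - (c i)\<^sup>2))"
    by (rule compl[OF 1]) (use YZc in auto)
  have YY: "Y1 * mat_adjoint Y1 = dg m (\<lambda>i. of_real (1 - (c i)\<^sup>2))"
    by (rule compl[OF 2]) (use YZc in auto)
  have c1: "1 - (c i)\<^sup>2 \<ge> 0" if "i < m" for i
    using adjoint_mult_diag_nonneg[OF YZc(2) ZZ that] .
  have s2: "dg m (\<lambda>i. of_real (1 - (c i)\<^sup>2)) = dg m (\<lambda>i. complex_of_real ((s i)\<^sup>2))"
    by (rule dg_cong) (simp only: s_def real_sqrt_pow2[OF c1])
  have s0: "s i \<ge> 0" if "i < m" for i using c1[OF that] by (simp add: s_def)
  have cs: "(c i)\<^sup>2 + (s i)\<^sup>2 = 1" if "i < m" for i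
    unfolding s_def real_sqrt_pow2[OF c1[OF that]] by simp
  let ?S = "dg m (\<lambda>i. \<i> * of_real (s i))"
  obtain V2 where V2: "V2 \<in> unitary_group m" "Z1 = V2 * ?S"
    using polar_diagonal_imaginary[of Z1 m s, OF YZc(2) s0 ZZ[unfolded s2]] by blast
  obtain V3 where V3: "V3 \<in> unitary_group m" "mat_adjoint Y1 = V3 * dg m (\<lambda>i. of_real (s i))"
    using polar_diagonal[of "mat_adjoint Y1" m s, unfolded mat_adjoint_adjoint,
        OF mat_adjoint_carrier[OF YZc(1)] s0 YY[unfolded s2]] by blast
  \<comment> \<open>For \<open>Y1\<close> the unitary has to stand on the right, so the polar
    decomposition was applied to the adjoint. The factor \<open>- \<i>\<close> compensates the
    \<open>\<i>\<close> in \<open>?S\<close>.\<close>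
  define V4 where "V4 = dg m (\<lambda>_. - \<i>) * mat_adjoint V3"
  have V4: "V4 \<in> unitary_group m"
    unfolding V4_def by (intro unitary_mult dg_unitary unitary_adjoint V3) simp
  note Vc = unitary_carrier[OF V2(1)] unitary_carrier[OF V3(1)] unitary_carrier[OF V4]
  have Y1: "Y1 = ?S * V4"
  proof -
    have "Y1 = mat_adjoint (V3 * dg m (\<lambda>i. of_real (s i)))"
      using arg_cong[OF V3(2), of mat_adjoint] by simp
    also have "\<dots> = dg m (\<lambda>i. of_real (s i)) * mat_adjoint V3"
      using Vc by (simp add: mat_adjoint_mult[of _ m m _ m] mat_adjoint_dg)
    also have "dg m (\<lambda>i. of_real (s i)) = ?S * dg m (\<lambda>_. - \<i>)"
      unfolding dg_mult by (rule dg_cong) (simp add: algebra_simps)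
    finally show ?thesis using Vc by (simp add: V4_def assoc_mult_mat[of _ m m _ m _ m])
  qed
  define W2 where "W2 = mat_adjoint V2 * W * mat_adjoint V4"
  have W2c: "W2 \<in> carrier_mat m m" using Vc blocks by (auto simp: W2_def)
  define U2 where "U2 = four_block_mat ?C ?S ?S W2"
  have U1U2: "U1 = bdiag (1\<^sub>m m) V2 * U2 * bdiag (1\<^sub>m m) V4"
  proof -
    have "W = V2 * W2 * V4"
      using Vc blocks by (simp add: W2_def mult_carrier_mat[of _ m m] unitary_adjoint_left[OF V4]
        mult_adjoint_cancel(1)[OF V2(1)] assoc_mult_mat[where ?n\<^sub>1.0 = m and ?n\<^sub>2.0 = m and ?n\<^sub>3.0 = m and ?n\<^sub>4.0 = m])
    then show ?thesis
      unfolding U1 U2_def bdiag_def using Vc W2c Y1 V2(2)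
      by (simp add: mult_four_block_mat[of _ m m _ m _ m _ _ m _ m] mult_carrier_mat[of _ m m])
  qed
  have bu: "bdiag (1\<^sub>m m) V \<in> unitary_group (m + m)" if "V \<in> unitary_group m" for V
    using that unitary_carrier[OF that] by (subst bdiag_unitary_iff) auto
  have U2u: "U2 \<in> unitary_group (m + m)"
  proof -
    note b = bu[OF V2(1)] bu[OF V4]
    note bc = unitary_carrier[OF b(1)] unitary_carrier[OF b(2)]
    have U2c: "U2 \<in> carrier_mat (m + m) (m + m)" using W2c by (auto simp: U2_def)
    have "U2 = mat_adjoint (bdiag (1\<^sub>m m) V2) * U1 * mat_adjoint (bdiag (1\<^sub>m m) V4)"
      unfolding U1U2 using bc U2c
      by (simp add: mult_carrier_mat[of _ "m + m" "m + m"] unitary_adjoint_right[OF b(2)]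
          mult_adjoint_cancel(2)[OF b(1)] assoc_mult_mat[where ?n\<^sub>1.0 = "m + m" and ?n\<^sub>2.0 = "m + m" and ?n\<^sub>3.0 = "m + m" and ?n\<^sub>4.0 = "m + m"])
    then show ?thesis by (metis unitary_mult unitary_adjoint b U1u)
  qed
  let ?K = "cs_mat m c s"
  have Ku: "?K \<in> unitary_group (m + m)" by (rule cs_mat_unitary[OF cs])
  \<comment> \<open>\<open>?K\<close> and \<open>U2\<close> agree in their first block column, so
    that of \<open>Q\<close> is that of the identity. Orthogonality to it then forces the upper
    right block \<open>E\<close> to vanish.\<close>
  define Q where "Q = mat_adjoint ?K * U2"
  have Qu: "Q \<in> unitary_group (m + m)"
    unfolding Q_def by (intro unitary_mult unitary_adjoint Ku U2u)
  let ?S' = "dg m (\<lambda>i. - (\<i> * of_real (s i)))"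
  define E where "E = ?C * ?S + ?S' * W2"
  define F where "F = ?S' * ?S + ?C * W2"
  have EFc: "E \<in> carrier_mat m m" "F \<in> carrier_mat m m" using W2c by (auto simp: E_def F_def)
  have "?C * ?C + ?S' * ?S = dg m (\<lambda>i. of_real ((c i)\<^sup>2 + (s i)\<^sup>2))"
    unfolding dg_mult dg_add by (rule dg_cong) (simp add: power2_eq_square algebra_simps)
  also have "\<dots> = dg m (\<lambda>_. 1)"
    by (rule dg_cong) (simp only: cs of_real_1)
  finally have t1: "?C * ?C + ?S' * ?S = 1\<^sub>m m" by (simp only: dg_one)
  have t2: "?S' * ?C + ?C * ?S = 0\<^sub>m m m"
    unfolding dg_mult dg_add dg_zero[symmetric] by (rule dg_cong) simp
  have Q: "Q = four_block_mat (1\<^sub>m m) E (0\<^sub>m m m) F"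
    unfolding Q_def cs_mat_def U2_def E_def F_def t1[symmetric] t2[symmetric] using W2c
    by (simp add: mat_adjoint_four_block[of _ m m _ m _ m] mat_adjoint_dg
        mult_four_block_mat[of _ m m _ m _ m _ _ m _ m])
  have "four_block_mat (1\<^sub>m m) E (mat_adjoint E) (mat_adjoint E * E + mat_adjoint F * F) =
      four_block_mat (1\<^sub>m m) (0\<^sub>m m m) (0\<^sub>m m m) (1\<^sub>m m)"
    using unitary_adjoint_left[OF Qu] EFc unfolding Q one
    by (simp add: mat_adjoint_four_block[of _ m m _ m _ m]
        mult_four_block_mat[of _ m m _ m _ m _ _ m _ m])
  then have "E = 0\<^sub>m m m"
    by (rule four_block_mat_inject[of _ m m _ m _ m, THEN conjunct2, THEN conjunct1, rotated 8])
      (use EFc in \<open>auto intro!: mult_carrier_mat add_carrier_mat\<close>)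
  then have Qb: "Q = bdiag (1\<^sub>m m) F" using Q EFc by (simp add: bdiag_def)
  have Fu: "F \<in> unitary_group m"
    using Qu EFc unfolding Qb by (subst (asm) bdiag_unitary_iff) auto
  have U2Q: "U2 = ?K * bdiag (1\<^sub>m m) F"
    using mult_adjoint_cancel(1)[OF Ku unitary_carrier[OF U2u]] Qb by (simp add: Q_def)
  have bP: "bdiag P (1\<^sub>m m) \<in> unitary_group (m + m)" and bR: "bdiag R (1\<^sub>m m) \<in> unitary_group (m + m)"
    using P R PRc by (auto simp: bdiag_unitary_iff)
  have "U = bdiag P (1\<^sub>m m) * U1 * bdiag (mat_adjoint R) (1\<^sub>m m)"
  proof -
    have a: "bdiag (mat_adjoint P) (1\<^sub>m m) = mat_adjoint (bdiag P (1\<^sub>m m))"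
      "bdiag (mat_adjoint R) (1\<^sub>m m) = mat_adjoint (bdiag R (1\<^sub>m m))"
      using PRc by (simp_all add: mat_adjoint_bdiag[of _ m _ m])
    show ?thesis
      unfolding U1_def a using unitary_carrier[OF U] unitary_carrier[OF bP] unitary_carrier[OF bR]
      by (simp add: mult_carrier_mat[of _ "m + m" "m + m"] unitary_adjoint_right[OF bR]
          mult_adjoint_cancel(1)[OF bP] assoc_mult_mat[where ?n\<^sub>1.0 = "m + m" and ?n\<^sub>2.0 = "m + m" and ?n\<^sub>3.0 = "m + m" and ?n\<^sub>4.0 = "m + m"])
  qed
  also have "\<dots> = (bdiag P (1\<^sub>m m) * bdiag (1\<^sub>m m) V2) * ?K *
      (bdiag (1\<^sub>m m) F * (bdiag (1\<^sub>m m) V4 * bdiag (mat_adjoint R) (1\<^sub>m m)))"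
    unfolding U1U2 U2Q
    using unitary_carrier[OF bP] unitary_carrier[OF Ku] unitary_carrier[OF bu[OF V2(1)]]
      unitary_carrier[OF bu[OF V4]] unitary_carrier[OF bu[OF Fu]]
      bdiag_carrier[OF mat_adjoint_carrier[OF PRc(2)] one_carrier_mat[of m]]
    by (simp add: mult_carrier_mat[of _ "m + m" "m + m"]
          assoc_mult_mat[where ?n\<^sub>1.0 = "m + m" and ?n\<^sub>2.0 = "m + m" and ?n\<^sub>3.0 = "m + m" and ?n\<^sub>4.0 = "m + m"])
  also have "\<dots> = bdiag P V2 * ?K * bdiag (mat_adjoint R) (F * V4)"
    using PRc Vc EFc by (simp add: bdiag_mult[of _ m _ m] mult_carrier_mat[of _ m m])
  finally have "U = bdiag P V2 * ?K * bdiag (mat_adjoint R) (F * V4)" .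
  with that[OF P V2(1) unitary_adjoint[OF R] unitary_mult[OF Fu V4], of c s] cs show ?thesis
    by blast
qed

lemma sum_product_split:
  fixes h :: "nat \<Rightarrow> 'a::comm_monoid_add"
  shows "(\<Sum>k<q * m. h k) = (\<Sum>a<q. \<Sum>b<m. h (a * m + b))"
proof (induction q)
  case (Suc q)
  have "{..<Suc q * m} = {..<q * m} \<union> (+) (q * m) ` {..<m}"
    unfolding lessThan_atLeast0 image_add_atLeastLessThan by (auto simp: algebra_simps)
  moreover have "{..<q * m} \<inter> (+) (q * m) ` {..<m} = {}" by auto
  ultimately have "(\<Sum>k<Suc q * m. h k) = (\<Sum>k<q * m. h k) + (\<Sum>k\<in>(+) (q * m) ` {..<m}. h k)"
    by (simp add: sum.union_disjoint)
  also have "(\<Sum>k\<in>(+) (q * m) ` {..<m}. h k) = (\<Sum>b<m. h (q * m + b))"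
    by (subst sum.reindex) auto
  finally show ?case by (simp add: Suc.IH)
qed simp

lemma div_mod_less:
  assumes "i < q * (m::nat)"
  shows "i div m < q" "i mod m < m"
  using assms by (auto simp: less_mult_imp_div_less intro: mod_less_divisor) (metis mod_less_divisor mult_0_right not_gr_zero not_less_zero)

subsection \<open>Block diagonal matrices and tensor products\<close>

text \<open>An index is read as \<open>a * m + b\<close>. In \<open>blk\<close> the high digit
  \<open>a\<close> selects a matrix for the low digit \<open>b\<close>; \<open>tens\<close> is
  \<open>V\<close> on the high digit tensored with the identity. The dimensions stay variable
  because the boundary between the two digits moves during the recursion.\<close>

definition blk :: "nat \<Rightarrow> nat \<Rightarrow> (nat \<Rightarrow> complex mat) \<Rightarrow> complex mat" where
  "blk q m f = mat (q * m) (q * m) (\<lambda>(i, j).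
     if i div m = j div m then f (i div m) $$ (i mod m, j mod m) else 0)"

definition tens :: "nat \<Rightarrow> nat \<Rightarrow> complex mat \<Rightarrow> complex mat" where
  "tens q m V = mat (q * m) (q * m) (\<lambda>(i, j).
     if i mod m = j mod m then V $$ (i div m, j div m) else 0)"

lemma blk_carrier [simp, intro]: "blk q m f \<in> carrier_mat (q * m) (q * m)"
  by (simp add: blk_def)

lemma tens_carrier [simp, intro]: "tens q m V \<in> carrier_mat (q * m) (q * m)"
  by (simp add: tens_def)

lemma dim_blk [simp]: "dim_row (blk q m f) = q * m" "dim_col (blk q m f) = q * m"
  by (simp_all add: blk_def)

lemma dim_tens [simp]: "dim_row (tens q m f) = q * m" "dim_col (tens q m f) = q * m"
  by (simp_all add: tens_def)

lemma index_blk: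
  "i < q * m \<Longrightarrow> j < q * m \<Longrightarrow> blk q m f $$ (i, j) =
     (if i div m = j div m then f (i div m) $$ (i mod m, j mod m) else 0)"
  by (simp add: blk_def)

lemma index_tens:
  "i < q * m \<Longrightarrow> j < q * m \<Longrightarrow> tens q m V $$ (i, j) =
     (if i mod m = j mod m then V $$ (i div m, j div m) else 0)"
  by (simp add: tens_def)

lemma blk_cong: "(\<And>a. a < q \<Longrightarrow> f a = g a) \<Longrightarrow> blk q m f = blk q m g"
  by (rule eq_matI) (auto simp: index_blk div_mod_less)

lemma blk_mult:
  assumes f: "\<And>a. a < q \<Longrightarrow> f a \<in> carrier_mat m m" and g: "\<And>a. a < q \<Longrightarrow> g a \<in> carrier_mat m m"
  shows "blk q m f * blk q m g = blk q m (\<lambda>a. f a * g a)"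
proof (rule eq_matI)
  fix i j assume "i < dim_row (blk q m (\<lambda>a. f a * g a))" "j < dim_col (blk q m (\<lambda>a. f a * g a))"
  then have ij: "i < q * m" "j < q * m" by auto
  note dm = div_mod_less[OF ij(1)] div_mod_less[OF ij(2)]
  have bd: "a * m + b < q * m" if "a < q" "b < m" for a b
    using that mult_le_mono1[of "Suc a" q m] by simp
  have "(blk q m f * blk q m g) $$ (i, j) = (\<Sum>k<q * m. blk q m f $$ (i, k) * blk q m g $$ (k, j))"
    by (rule index_mult_mat_sum) (use ij in auto)
  also have "\<dots> = (\<Sum>a<q. \<Sum>b<m. blk q m f $$ (i, a * m + b) * blk q m g $$ (a * m + b, j))"
    by (rule sum_product_split)
  also have "\<dots> = (\<Sum>a<q. if a = i div m then if i div m = j div m then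
      \<Sum>b<m. f (i div m) $$ (i mod m, b) * g (i div m) $$ (b, j mod m) else 0 else 0)"
    using ij by (intro sum.cong) (auto simp: index_blk bd)
  also have "\<dots> = (if i div m = j div m then
      \<Sum>b<m. f (i div m) $$ (i mod m, b) * g (i div m) $$ (b, j mod m) else 0)"
    using dm by simp
  also have "\<dots> = blk q m (\<lambda>a. f a * g a) $$ (i, j)"
    using ij dm by (simp add: index_blk index_mult_mat_sum[OF f g])
  finally show "(blk q m f * blk q m g) $$ (i, j) = blk q m (\<lambda>a. f a * g a) $$ (i, j)" .
qed auto

lemma tens_mult:
  assumes V: "V \<in> carrier_mat q q" and W: "W \<in> carrier_mat q q"
  shows "tens q m V * tens q m W = tens q m (V * W)"
proof (rule eq_matI)
  fix i j assume "i < dim_row (tens q m (V * W))" "j < dim_col (tens q m (V * W))"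
  then have ij: "i < q * m" "j < q * m" by auto
  note dm = div_mod_less[OF ij(1)] div_mod_less[OF ij(2)]
  have bd: "a * m + b < q * m" if "a < q" "b < m" for a b
    using that mult_le_mono1[of "Suc a" q m] by simp
  have "(tens q m V * tens q m W) $$ (i, j) = (\<Sum>k<q * m. tens q m V $$ (i, k) * tens q m W $$ (k, j))"
    by (rule index_mult_mat_sum) (use ij in auto)
  also have "\<dots> = (\<Sum>a<q. \<Sum>b<m. tens q m V $$ (i, a * m + b) * tens q m W $$ (a * m + b, j))"
    by (rule sum_product_split)
  also have "\<dots> = (\<Sum>a<q. \<Sum>b<m. if b = i mod m then if i mod m = j mod m then
      V $$ (i div m, a) * W $$ (a, j div m) else 0 else 0)"
    using ij by (intro sum.cong) (auto simp: index_tens bd)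
  also have "\<dots> = (if i mod m = j mod m then \<Sum>a<q. V $$ (i div m, a) * W $$ (a, j div m) else 0)"
    using dm by simp
  also have "\<dots> = tens q m (V * W) $$ (i, j)"
    using ij dm by (simp add: index_tens index_mult_mat_sum[OF V W])
  finally show "(tens q m V * tens q m W) $$ (i, j) = tens q m (V * W) $$ (i, j)" .
qed auto

lemma blk_one: "blk q m (\<lambda>_. 1\<^sub>m m) = 1\<^sub>m (q * m)"
proof (rule eq_matI)
  fix i j assume "i < dim_row (1\<^sub>m (q * m) :: complex mat)" "j < dim_col (1\<^sub>m (q * m) :: complex mat)"
  then show "blk q m (\<lambda>_. 1\<^sub>m m) $$ (i, j) = (1\<^sub>m (q * m) :: complex mat) $$ (i, j)"
    by (auto simp: index_blk div_mod_less) (metis div_mult_mod_eq)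
qed auto

lemma tens_one: "tens q m (1\<^sub>m q) = 1\<^sub>m (q * m)"
proof (rule eq_matI)
  fix i j assume "i < dim_row (1\<^sub>m (q * m) :: complex mat)" "j < dim_col (1\<^sub>m (q * m) :: complex mat)"
  then show "tens q m (1\<^sub>m q) $$ (i, j) = (1\<^sub>m (q * m) :: complex mat) $$ (i, j)"
    by (auto simp: index_tens div_mod_less) (metis div_mult_mod_eq)
qed auto

lemma blk_adjoint:
  assumes "\<And>a. a < q \<Longrightarrow> f a \<in> carrier_mat m m"
  shows "mat_adjoint (blk q m f) = blk q m (\<lambda>a. mat_adjoint (f a))"
proof (rule eq_matI)
  fix i j assume "i < dim_row (blk q m (\<lambda>a. mat_adjoint (f a)))" "j < dim_col (blk q m (\<lambda>a. mat_adjoint (f a)))"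
  then have ij: "i < q * m" "j < q * m" by auto
  note dm = div_mod_less[OF ij(1)] div_mod_less[OF ij(2)]
  show "mat_adjoint (blk q m f) $$ (i, j) = blk q m (\<lambda>a. mat_adjoint (f a)) $$ (i, j)"
    using ij dm assms[of "i div m"] by (auto simp: index_blk)
qed auto

lemma tens_adjoint:
  assumes "V \<in> carrier_mat q q"
  shows "mat_adjoint (tens q m V) = tens q m (mat_adjoint V)"
proof (rule eq_matI)
  fix i j assume "i < dim_row (tens q m (mat_adjoint V))" "j < dim_col (tens q m (mat_adjoint V))"
  then have ij: "i < q * m" "j < q * m" by auto
  note dm = div_mod_less[OF ij(1)] div_mod_less[OF ij(2)]
  show "mat_adjoint (tens q m V) $$ (i, j) = tens q m (mat_adjoint V) $$ (i, j)"
    using ij dm assms by (simp add: index_tens)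
qed auto

lemma blk_unitary:
  assumes "\<And>a. a < q \<Longrightarrow> f a \<in> unitary_group m"
  shows "blk q m f \<in> unitary_group (q * m)"
proof -
  have c: "f a \<in> carrier_mat m m" if "a < q" for a by (rule unitary_carrier[OF assms[OF that]])
  have "mat_adjoint (blk q m f) * blk q m f = blk q m (\<lambda>a. mat_adjoint (f a) * f a)"
    using c by (simp add: blk_adjoint blk_mult)
  also have "\<dots> = blk q m (\<lambda>_. 1\<^sub>m m)"
    by (rule blk_cong) (simp add: unitary_adjoint_left assms)
  finally show ?thesis by (simp add: unitary_group_def blk_one)
qed

lemma tens_unitary: "V \<in> unitary_group q \<Longrightarrow> tens q m V \<in> unitary_group (q * m)"
  by (simp add: unitary_group_def tens_adjoint tens_mult tens_one)

text \<open>Phases that depend only on the block are a diagonal gate within A and therefore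
  free.\<close>

lemma tens_dg: "tens q m (dg q v) = blk q m (\<lambda>a. dg m (\<lambda>_. v a))"
  by (rule eq_matI) (auto simp: index_blk index_tens div_mod_less)

lemma blk_dg: "blk q m (\<lambda>a. dg m (f a)) = dg (q * m) (\<lambda>i. f (i div m) (i mod m))"
proof (rule eq_matI)
  fix i j assume "i < dim_row (dg (q * m) (\<lambda>i. f (i div m) (i mod m)))"
    "j < dim_col (dg (q * m) (\<lambda>i. f (i div m) (i mod m)))"
  then show "blk q m (\<lambda>a. dg m (f a)) $$ (i, j) = dg (q * m) (\<lambda>i. f (i div m) (i mod m)) $$ (i, j)"
    by (auto simp: index_blk div_mod_less) (metis div_mult_mod_eq)
qed auto

text \<open>A diagonal matrix can be cut into blocks of any size; this moves the middle factor of
  the cosine-sine decomposition from large blocks to blocks of size \<open>d\<close>.\<close>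

lemma dg_blk: "dg (q * m) f = blk q m (\<lambda>a. dg m (\<lambda>b. f (a * m + b)))"
  by (simp add: blk_dg)

text \<open>Halving the blocks doubles their number: upper halves get even positions, lower halves
  odd ones. In this form the outer factors of the cosine-sine decomposition meet the induction
  hypothesis.\<close>

lemma blk_bdiag:
  assumes L: "\<And>a. a < q \<Longrightarrow> L1 a \<in> carrier_mat m m" "\<And>a. a < q \<Longrightarrow> L2 a \<in> carrier_mat m m"
  shows "blk q (m + m) (\<lambda>a. bdiag (L1 a) (L2 a)) =
    blk (2 * q) m (\<lambda>a. if even a then L1 (a div 2) else L2 (a div 2))" (is "?A = ?B")
proof (rule eq_matI)
  fix i j assume "i < dim_row ?B" "j < dim_col ?B"
  then have ij: "i < q * (m + m)" "j < q * (m + m)" by (auto simp: algebra_simps)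
  then have m: "m > 0" by (cases m) auto
  have half: "k div m = 2 * (k div (m + m)) + (if k mod (m + m) < m then 0 else 1)"
    "k mod m = (if k mod (m + m) < m then k mod (m + m) else k mod (m + m) - m)" for k
  proof -
    have e: "k div (m + m) = k div m div 2" "k mod (m + m) = m * (k div m mod 2) + k mod m"
      using div_mult2_eq[of k m 2] mod_mult2_eq[of k m 2] by (simp_all add: mult_2_right)
    have "k mod m < m" using m by simp
    moreover have "k div m = 2 * (k div m div 2) + k div m mod 2" by simp
    ultimately show "k mod m = (if k mod (m + m) < m then k mod (m + m) else k mod (m + m) - m)"
      "k div m = 2 * (k div (m + m)) + (if k mod (m + m) < m then 0 else 1)"
      unfolding e by (cases "k div m mod 2 = 0"; simp)+
  qed
  note dm = div_mod_less[OF ij(1)] div_mod_less[OF ij(2)]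
  have ij': "i < 2 * q * m" "j < 2 * q * m" using ij by (auto simp: algebra_simps)
  show "?A $$ (i, j) = ?B $$ (i, j)"
    unfolding index_blk[OF ij] index_blk[OF ij'] half[of i] half[of j]
    using dm L by (auto simp: index_bdiag[of _ m _ m] elim: oddE)
qed (auto simp: algebra_simps)

subsection \<open>Permutation matrices of involutions\<close>

text \<open>Every permutation of basis states used below is its own inverse, so one matrix serves on
  both sides of a conjugation.\<close>

definition involution_on :: "nat \<Rightarrow> (nat \<Rightarrow> nat) \<Rightarrow> bool" where
  "involution_on n \<sigma> \<longleftrightarrow> (\<forall>i<n. \<sigma> i < n \<and> \<sigma> (\<sigma> i) = i)"

lemma involution_onD:
  assumes "involution_on n \<sigma>" "i < n"
  shows "\<sigma> i < n" "\<sigma> (\<sigma> i) = i"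
  using assms by (auto simp: involution_on_def)

lemma involution_on_eq_iff:
  assumes "involution_on n \<sigma>" "i < n" "j < n"
  shows "\<sigma> i = \<sigma> j \<longleftrightarrow> i = j" "i = \<sigma> j \<longleftrightarrow> j = \<sigma> i"
  using involution_onD[OF assms(1)] assms(2,3) by metis+

definition inv_mat :: "nat \<Rightarrow> (nat \<Rightarrow> nat) \<Rightarrow> complex mat" where
  "inv_mat n \<sigma> = mat n n (\<lambda>(i, j). if i = \<sigma> j then 1 else 0)"

lemma inv_mat_carrier [simp, intro]: "inv_mat n \<sigma> \<in> carrier_mat n n"
  by (simp add: inv_mat_def)

lemma dim_inv_mat [simp]: "dim_row (inv_mat n \<sigma>) = n" "dim_col (inv_mat n \<sigma>) = n"
  by (simp_all add: inv_mat_def)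

lemma index_inv_mat: "i < n \<Longrightarrow> j < n \<Longrightarrow> inv_mat n \<sigma> $$ (i, j) = (if i = \<sigma> j then 1 else 0)"
  by (simp add: inv_mat_def)

lemma index_mult_inv_mat:
  assumes "involution_on n \<sigma>" "A \<in> carrier_mat m n" "i < m" "j < n"
  shows "(A * inv_mat n \<sigma>) $$ (i, j) = A $$ (i, \<sigma> j)"
proof -
  have "(A * inv_mat n \<sigma>) $$ (i, j) = (\<Sum>k<n. A $$ (i, k) * inv_mat n \<sigma> $$ (k, j))"
    by (rule index_mult_mat_sum) (use assms in auto)
  also have "\<dots> = (\<Sum>k<n. if k = \<sigma> j then A $$ (i, \<sigma> j) else 0)"
    using assms by (intro sum.cong) (auto simp: index_inv_mat)
  finally show ?thesis using involution_onD[OF assms(1)] assms by simp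
qed

lemma index_inv_mat_mult:
  assumes "involution_on n \<sigma>" "A \<in> carrier_mat n m" "i < n" "j < m"
  shows "(inv_mat n \<sigma> * A) $$ (i, j) = A $$ (\<sigma> i, j)"
proof -
  have "(inv_mat n \<sigma> * A) $$ (i, j) = (\<Sum>k<n. inv_mat n \<sigma> $$ (i, k) * A $$ (k, j))"
    by (rule index_mult_mat_sum) (use assms in auto)
  also have "\<dots> = (\<Sum>k<n. if k = \<sigma> i then A $$ (\<sigma> i, j) else 0)"
    using involution_on_eq_iff(2)[OF assms(1)] assms by (intro sum.cong) (auto simp: index_inv_mat)
  finally show ?thesis using involution_onD[OF assms(1)] assms by simp
qed

lemma inv_mat_square:
  assumes \<sigma>: "involution_on n \<sigma>"
  shows "inv_mat n \<sigma> * inv_mat n \<sigma> = 1\<^sub>m n"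
proof (rule eq_matI)
  fix i j assume "i < dim_row (1\<^sub>m n :: complex mat)" "j < dim_col (1\<^sub>m n :: complex mat)"
  then have ij: "i < n" "j < n" by auto
  show "(inv_mat n \<sigma> * inv_mat n \<sigma>) $$ (i, j) = (1\<^sub>m n :: complex mat) $$ (i, j)"
    unfolding index_mult_inv_mat[OF \<sigma> inv_mat_carrier ij]
    using ij involution_onD[OF \<sigma> ij(2)] by (simp add: index_inv_mat)
qed auto

lemma inv_mat_adjoint:
  assumes \<sigma>: "involution_on n \<sigma>"
  shows "mat_adjoint (inv_mat n \<sigma>) = inv_mat n \<sigma>"
proof (rule eq_matI)
  fix i j assume "i < dim_row (inv_mat n \<sigma>)" "j < dim_col (inv_mat n \<sigma>)"
  then have ij: "i < n" "j < n" by auto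
  then show "mat_adjoint (inv_mat n \<sigma>) $$ (i, j) = inv_mat n \<sigma> $$ (i, j)"
    using involution_on_eq_iff(2)[OF \<sigma> ij] by (simp add: index_inv_mat)
qed auto

lemma inv_mat_unitary: "involution_on n \<sigma> \<Longrightarrow> inv_mat n \<sigma> \<in> unitary_group n"
  by (simp add: unitary_group_def inv_mat_adjoint inv_mat_square)

lemma inv_mat_conj_dg:
  assumes \<sigma>: "involution_on n \<sigma>"
  shows "inv_mat n \<sigma> * dg n f * inv_mat n \<sigma> = dg n (\<lambda>i. f (\<sigma> i))"
proof (rule eq_matI)
  fix i j assume "i < dim_row (dg n (\<lambda>i. f (\<sigma> i)))" "j < dim_col (dg n (\<lambda>i. f (\<sigma> i)))"
  then have ij: "i < n" "j < n" by auto
  note facts = involution_on_eq_iff(1)[OF \<sigma> ij] involution_onD(1)[OF \<sigma> ij(1)] involution_onD(1)[OF \<sigma> ij(2)]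
  show "(inv_mat n \<sigma> * dg n f * inv_mat n \<sigma>) $$ (i, j) = dg n (\<lambda>i. f (\<sigma> i)) $$ (i, j)"
    using ij facts by (simp add: index_mult_inv_mat[OF \<sigma>, of _ n] index_inv_mat_mult[OF \<sigma>, of _ n]
        mult_carrier_mat[of _ n n])
qed auto

text \<open>Renaming the basis states of A permutes the blocks: the tensor product is itself the
  matrix of an involution, which moves the high digit and keeps the low one.\<close>

lemma tens_inv_mat_conj:
  assumes \<sigma>: "involution_on q \<sigma>"
  shows "tens q m (inv_mat q \<sigma>) * blk q m f * tens q m (inv_mat q \<sigma>) = blk q m (\<lambda>a. f (\<sigma> a))"
proof -
  let ?\<tau> = "\<lambda>k. \<sigma> (k div m) * m + k mod m"
  have lt: "?\<tau> k < q * m" if "k < q * m" for k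
    using involution_onD(1)[OF \<sigma> div_mod_less(1)[OF that]] div_mod_less(2)[OF that]
      mult_le_mono1[of "Suc (\<sigma> (k div m))" q m] by simp
  have \<tau>: "involution_on (q * m) ?\<tau>"
    unfolding involution_on_def[of "q * m"]
  proof (intro allI impI conjI)
    fix i assume i: "i < q * m"
    note dm = div_mod_less[OF i]
    show "?\<tau> i < q * m" by (rule lt[OF i])
    have "?\<tau> i div m = \<sigma> (i div m)" "?\<tau> i mod m = i mod m" using dm by simp_all
    then show "?\<tau> (?\<tau> i) = i" using involution_onD(2)[OF \<sigma> dm(1)] by simp
  qed
  have T: "tens q m (inv_mat q \<sigma>) = inv_mat (q * m) ?\<tau>"
  proof (rule eq_matI)
    fix i j assume "i < dim_row (inv_mat (q * m) ?\<tau>)" "j < dim_col (inv_mat (q * m) ?\<tau>)"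
    then have ij: "i < q * m" "j < q * m" by (auto simp: inv_mat_def)
    note dm = div_mod_less[OF ij(1)] div_mod_less[OF ij(2)]
    have "(i mod m = j mod m \<and> i div m = \<sigma> (j div m)) = (i = ?\<tau> j)"
    proof
      assume "i mod m = j mod m \<and> i div m = \<sigma> (j div m)"
      then show "i = ?\<tau> j" using div_mult_mod_eq[of i m] by simp
    next
      assume "i = ?\<tau> j"
      then show "i mod m = j mod m \<and> i div m = \<sigma> (j div m)" using dm(4) by simp
    qed
    then show "tens q m (inv_mat q \<sigma>) $$ (i, j) = inv_mat (q * m) ?\<tau> $$ (i, j)"
      using ij dm by (auto simp: index_tens index_inv_mat)
  qed auto
  show ?thesis
  proof (rule eq_matI)
    fix i j assume "i < dim_row (blk q m (\<lambda>a. f (\<sigma> a)))" "j < dim_col (blk q m (\<lambda>a. f (\<sigma> a)))"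
    then have ij: "i < q * m" "j < q * m" by auto
    note dm = div_mod_less[OF ij(1)] div_mod_less[OF ij(2)]
    have "\<sigma> (i div m) = \<sigma> (j div m) \<longleftrightarrow> i div m = j div m"
      by (rule involution_on_eq_iff(1)[OF \<sigma> dm(1,3)])
    then show "(tens q m (inv_mat q \<sigma>) * blk q m f * tens q m (inv_mat q \<sigma>)) $$ (i, j) =
        blk q m (\<lambda>a. f (\<sigma> a)) $$ (i, j)"
      unfolding T using ij dm lt[OF ij(1)] lt[OF ij(2)]
      by (simp add: index_mult_inv_mat[OF \<tau>, of _ "q * m"] index_inv_mat_mult[OF \<tau>, of _ "q * m"]
          mult_carrier_mat[of _ "q * m" "q * m"] index_blk)
  qed auto
qed

subsection \<open>Operators of bounded straddling cost\<close>

text \<open>Complements bit 0, so it is the NOT on the lowest qubit of B. The same pairing (0,1),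
  (2,3), ... later organizes conjugate eigenvalues.\<close>

definition flip :: "nat \<Rightarrow> nat" where
  "flip b = (if even b then b + 1 else b - 1)"

definition cx_blk :: "nat \<Rightarrow> nat \<Rightarrow> complex mat" where
  "cx_blk d a = (if odd a then inv_mat d flip else 1\<^sub>m d)"

text \<open>Operators on \<open>C^d \<otimes> C^d\<close>, with basis index \<open>a * d + b\<close> where \<open>a\<close> belongs to A and \<open>b\<close> to B. The
  only straddling gate used is a controlled-NOT on the lowest qubits of A and B, so
  \<open>realizable d c M\<close> says that \<open>M\<close> needs \<open>c\<close> controlled-NOTs besides local gates.\<close>

inductive realizable :: "nat \<Rightarrow> nat \<Rightarrow> complex mat \<Rightarrow> bool" for d where
  local_A: "V \<in> unitary_group d \<Longrightarrow> realizable d 0 (tens d d V)"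
| local_B: "V \<in> unitary_group d \<Longrightarrow> realizable d 0 (blk d d (\<lambda>_. V))"
| cx: "realizable d 1 (blk d d (cx_blk d))"
| mult: "realizable d c M \<Longrightarrow> realizable d c' N \<Longrightarrow> realizable d (c + c') (M * N)"

lemma involution_flip: "even d \<Longrightarrow> involution_on d flip"
  by (auto simp: involution_on_def flip_def elim!: evenE oddE)

lemma realizable_mult0: "realizable d 0 M \<Longrightarrow> realizable d c N \<Longrightarrow> realizable d c (M * N)" "realizable d c N \<Longrightarrow> realizable d 0 M \<Longrightarrow> realizable d c (N * M)"
  using mult[of d 0 M c N] mult[of d c N 0 M] by auto

lemma realizable_blk_mult:
  assumes "realizable d c (blk d d f)" "realizable d c' (blk d d g)"
    "\<And>a. a < d \<Longrightarrow> f a \<in> carrier_mat d d" "\<And>a. a < d \<Longrightarrow> g a \<in> carrier_mat d d"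
  shows "realizable d (c + c') (blk d d (\<lambda>a. f a * g a))"
  using mult[OF assms(1,2)] assms(3,4) by (simp add: blk_mult)

text \<open>The set of basis states of A on which a controlled operation fires can be permuted for
  free.\<close>

lemma realizable_conj_A:
  assumes "realizable d c (blk d d f)" "involution_on d \<sigma>"
  shows "realizable d c (blk d d (\<lambda>a. f (\<sigma> a)))"
proof -
  have T: "realizable d 0 (tens d d (inv_mat d \<sigma>))"
    by (intro local_A inv_mat_unitary assms)
  have "realizable d c (tens d d (inv_mat d \<sigma>) * blk d d f * tens d d (inv_mat d \<sigma>))"
    by (intro realizable_mult0 T assms(1))
  then show ?thesis by (simp add: tens_inv_mat_conj[OF assms(2)])
qed

text \<open>Blocks equal to the identity stay so, while the others become arbitrary unitary
  conjugates. One controlled-NOT thus yields any controlled conjugate of the NOT.\<close>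

lemma realizable_conj_B:
  assumes "realizable d c (blk d d f)" "Q \<in> unitary_group d" "\<And>a. a < d \<Longrightarrow> f a \<in> carrier_mat d d"
  shows "realizable d c (blk d d (\<lambda>a. Q * f a * mat_adjoint Q))"
proof -
  have "realizable d c (blk d d (\<lambda>_. Q) * blk d d f * blk d d (\<lambda>_. mat_adjoint Q))"
    by (intro realizable_mult0 local_B unitary_adjoint assms)
  then show ?thesis
    using assms(3) unitary_carrier[OF assms(2)] by (simp add: blk_mult mult_carrier_mat[of _ d d])
qed

section \<open>Unitaries on B controlled by a single basis state of A\<close>

definition at_block :: "nat \<Rightarrow> nat \<Rightarrow> complex mat \<Rightarrow> nat \<Rightarrow> complex mat" where
  "at_block d i W a = (if a = i then W else 1\<^sub>m d)"

lemma at_block_carrier: "W \<in> carrier_mat d d \<Longrightarrow> at_block d i W a \<in> carrier_mat d d"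
  by (simp add: at_block_def)

text \<open>With \<open>R = D X D\<^sup>*\<close> an involution such that \<open>R X\<close> is the wanted diagonal matrix \<open>V\<close>, and
  \<open>\<tau>\<close> exchanging the blocks 0 and 1, the product of controlled involutions below equals \<open>V * V\<close> on
  block 0 and cancels on all others.\<close>

lemma realizable_diagonal_square:
  assumes d: "even d" "d > 0" and g: "\<And>b. b < d \<Longrightarrow> cmod (g b) = 1" "\<And>b. b < d \<Longrightarrow> g (flip b) = cnj (g b)"
  shows "realizable d 8 (blk d d (at_block d 0 (dg d (\<lambda>b. g b * g b))))"
proof -
  from d have d2: "d \<ge> 2" by (auto elim: evenE)
  define X where "X = inv_mat d flip"
  note inv = involution_flip[OF d(1)]
  have Xu: "X \<in> unitary_group d" unfolding X_def by (rule inv_mat_unitary[OF inv])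
  have XX: "X * X = 1\<^sub>m d" unfolding X_def by (rule inv_mat_square[OF inv])
  \<comment> \<open>Each pair carries its phase on the even member only. Then \<open>R * X\<close>
    has the entry \<open>e b * cnj (e (flip b))\<close>, which is \<open>g b\<close> for even
    \<open>b\<close> and \<open>cnj (g (flip b)) = g b\<close> for odd \<open>b\<close>.\<close>
  define e where "e b = (if even b then g b else 1)" for b
  define D where "D = dg d e"
  have Du: "D \<in> unitary_group d" unfolding D_def by (rule dg_unitary) (simp add: e_def g)
  define R where "R = D * X * mat_adjoint D"
  note c = unitary_carrier[OF Xu] unitary_carrier[OF Du]
  have Rc: "R \<in> carrier_mat d d" using c by (auto simp: R_def)
  note simps = assoc_mult_mat[where ?n\<^sub>1.0 = d and ?n\<^sub>2.0 = d and ?n\<^sub>3.0 = d and ?n\<^sub>4.0 = d]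
    mult_carrier_mat[of _ d d]
  have XXc: "X * (X * A) = A" if "A \<in> carrier_mat d d" for A
    using that c XX by (simp flip: assoc_mult_mat[where ?n\<^sub>1.0 = d and ?n\<^sub>2.0 = d and ?n\<^sub>3.0 = d and ?n\<^sub>4.0 = d])
  have RR: "R * R = 1\<^sub>m d"
    using c by (simp add: R_def simps mult_adjoint_cancel(2)[OF Du, of _ d] XXc unitary_adjoint_right[OF Du])
  have RRc: "R * (R * A) = A" if "A \<in> carrier_mat d d" for A
    using that Rc RR by (simp flip: assoc_mult_mat[where ?n\<^sub>1.0 = d and ?n\<^sub>2.0 = d and ?n\<^sub>3.0 = d and ?n\<^sub>4.0 = d])
  have "X * mat_adjoint D * X = dg d (\<lambda>b. cnj (e (flip b)))"
    unfolding X_def D_def mat_adjoint_dg by (rule inv_mat_conj_dg[OF inv])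
  then have "R * X = D * dg d (\<lambda>b. cnj (e (flip b)))"
    using c by (simp add: R_def simps)
  also have "\<dots> = dg d g"
    unfolding D_def dg_mult
  proof (rule dg_cong)
    fix b assume b: "b < d"
    have "flip b < d" "flip (flip b) = b" using involution_onD[OF inv b] by auto
    moreover have "even (flip b) = odd b" by (auto simp: flip_def)
    ultimately show "e b * cnj (e (flip b)) = g b"
      using g(2)[of "flip b"] by (auto simp: e_def)
  qed
  finally have RX: "R * X = dg d g" .
  define fR where "fR a = (if odd a then R else 1\<^sub>m d)" for a :: nat
  define fX where "fX a = (if odd a then X else 1\<^sub>m d)" for a :: nat
  have carr: "fR a \<in> carrier_mat d d" "fX a \<in> carrier_mat d d" for a
    using c Rc by (auto simp: fR_def fX_def)
  have fX: "realizable d 1 (blk d d fX)"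
    using cx[of d] unfolding cx_blk_def[abs_def] fX_def[abs_def] X_def .
  have "blk d d (\<lambda>a. D * fX a * mat_adjoint D) = blk d d fR"
    by (rule blk_cong) (use c in \<open>auto simp: fX_def fR_def R_def unitary_adjoint_right[OF Du]\<close>)
  then have fR: "realizable d 1 (blk d d fR)"
    using realizable_conj_B[OF fX Du carr(2)] by simp
  define \<tau> where "\<tau> a = (if a = 0 then 1 else if a = 1 then 0 else a)" for a :: nat
  have \<tau>: "involution_on d \<tau>" using d2 by (auto simp: involution_on_def \<tau>_def)
  note fXt = realizable_conj_A[OF fX \<tau>] and fRt = realizable_conj_A[OF fR \<tau>]
  \<comment> \<open>Each factor costs one controlled-NOT. Block 0 sees \<open>R X R X\<close>, block
    1 sees \<open>R X X R\<close>, every other odd block \<open>R R X X R X X R\<close>, and every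
    other even block only identities.\<close>
  have "realizable d (1+1+1+1+1+1+1+1)
    (blk d d (\<lambda>a. fR (\<tau> a) * fR a * fX (\<tau> a) * fX a * fR (\<tau> a) * fX (\<tau> a) * fX a * fR a))"
    by (intro realizable_blk_mult fX fR fXt fRt mult_carrier_mat[of _ d d] carr)
  moreover have "blk d d (\<lambda>a. fR (\<tau> a) * fR a * fX (\<tau> a) * fX a * fR (\<tau> a) * fX (\<tau> a) * fX a * fR a) =
      blk d d (at_block d 0 (dg d (\<lambda>b. g b * g b)))"
  proof (rule blk_cong)
    fix a :: nat
    consider "a = 0" | "a = 1" | "a \<noteq> 0" "a \<noteq> 1" by blast
    then show "fR (\<tau> a) * fR a * fX (\<tau> a) * fX a * fR (\<tau> a) * fX (\<tau> a) * fX a * fR a =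
        at_block d 0 (dg d (\<lambda>b. g b * g b)) a"
    proof cases
      case 1
      then show ?thesis
        using Rc c RX by (simp add: fR_def fX_def \<tau>_def at_block_def dg_mult[symmetric])
          (simp add: RX[symmetric] simps)
    next
      case 2
      then show ?thesis
        using Rc c by (simp add: fR_def fX_def \<tau>_def at_block_def simps XXc RR)
    next
      case 3
      then show ?thesis
        using Rc c by (simp add: fR_def fX_def \<tau>_def at_block_def simps XX XXc RR RRc)
    qed
  qed
  ultimately show ?thesis by (simp add: eval_nat_numeral)
qed

text \<open>Square roots are taken on the even member of each pair and conjugated onto the odd one.
  Principal roots on both members would break the pairing at the entry -1, which is its own
  conjugate while its root \<open>\<i>\<close> is not.\<close>

lemma realizable_diagonal_paired:
  assumes d: "even d" "d > 0" and u: "\<And>b. b < d \<Longrightarrow> cmod (u b) = 1" "\<And>b. b < d \<Longrightarrow> u (flip b) = cnj (u b)"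
  shows "realizable d 8 (blk d d (at_block d 0 (dg d u)))"
proof -
  note inv = involution_flip[OF d(1)]
  define g where "g b = (if even b then csqrt (u b) else cnj (csqrt (u (flip b))))" for b
  have ev: "even (flip b) = odd b" for b by (auto simp: flip_def)
  have ff: "flip b < d" "flip (flip b) = b" if "b < d" for b
    using involution_onD[OF inv that] by auto
  have "realizable d 8 (blk d d (at_block d 0 (dg d (\<lambda>b. g b * g b))))"
    by (rule realizable_diagonal_square[OF d]) (use u ff in \<open>auto simp: g_def ev norm_csqrt\<close>)
  moreover have "dg d (\<lambda>b. g b * g b) = dg d u"
  proof (rule dg_cong)
    fix b assume b: "b < d"
    have "csqrt z * csqrt z = z" for z using power2_csqrt[of z] by (simp add: power2_eq_square)
    then show "g b * g b = u b"
      using u(2)[OF b] by (simp add: g_def flip: complex_cnj_mult)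
  qed
  ultimately show ?thesis by simp
qed

lemma unit_mult_cnj: "cmod z = 1 \<Longrightarrow> z * cnj z = 1" "cmod z = 1 \<Longrightarrow> cnj z * z = 1"
  by (simp_all add: complex_norm_square[symmetric] mult.commute)

text \<open>A diagonal matrix of determinant 1 is a product of two matrices whose entries are paired to
  conjugates along the pairs (0,1), (2,3), ... and (1,2), (3,4), ..., (d-1,0), respectively. The
  partial products solve for the entries.\<close>

lemma realizable_diagonal_det_one:
  assumes d: "even d" "d > 0" and f: "\<And>b. b < d \<Longrightarrow> cmod (f b) = 1" "(\<Prod>b<d. f b) = 1"
  shows "realizable d 16 (blk d d (at_block d 0 (dg d f)))"
proof -
  note inv = involution_flip[OF d(1)]
  define F where "F b = (\<Prod>c<b. f c)" for b
  have F1: "cmod (F b) = 1" if "b \<le> d" for b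
    using that f(1) by (simp add: F_def prod_norm[symmetric])
  have FS: "F (Suc b) = F b * f b" for b by (simp add: F_def)
  have F0: "F 0 = 1" "F d = 1" using f(2) by (auto simp: F_def)
  define u where "u b = (if even b then F (Suc b) else cnj (F b))" for b
  define v where "v b = (if even b then cnj (F b) else F (Suc b))" for b
  have uv: "f b = u b * v b" if b: "b < d" for b
  proof -
    have "F b * cnj (F b) = 1" using F1[of b] b by (intro unit_mult_cnj) simp
    then show ?thesis by (simp add: u_def v_def FS algebra_simps)
  qed
  \<comment> \<open>Negation modulo \<open>d\<close>. It carries the pairs (0,1), (2,3), ... to the
    shifted pairs and is an involution, which a cyclic shift is not in general.\<close>
  define \<rho> where "\<rho> b = (if b = 0 then 0 else d - b)" for b
  have \<rho>: "involution_on d \<rho>" by (auto simp: involution_on_def \<rho>_def)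
  have u: "realizable d 8 (blk d d (at_block d 0 (dg d u)))"
    by (rule realizable_diagonal_paired[OF d]) (use F1 in \<open>auto simp: u_def flip_def\<close>)
  have v1: "cmod (v b) = 1" if "b < d" for b
    using F1 that by (auto simp: v_def)
  have pair: "v (\<rho> (Suc b)) = cnj (v (\<rho> b))" if b: "even b" "b < d" for b
  proof (cases "b = 0")
    case True
    \<comment> \<open>The pair that closes the cycle: \<open>v (d - 1) = F d\<close> has to be
      conjugate to \<open>v 0 = 1\<close>, and this is the condition on the determinant.\<close>
    have "d > 0" using b by auto
    then show ?thesis using True d F0 by (simp add: \<rho>_def v_def)
  next
    case False
    have "Suc b < d" using b d by (metis Suc_lessI even_Suc)
    moreover have "even (d - b)" "odd (d - Suc b)" using b d \<open>Suc b < d\<close> by auto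
    moreover have "Suc (d - Suc b) = d - b" using \<open>Suc b < d\<close> by simp
    ultimately show ?thesis using False b by (simp add: \<rho>_def v_def)
  qed
  have "realizable d 8 (blk d d (at_block d 0 (dg d (\<lambda>b. v (\<rho> b)))))"
  proof (rule realizable_diagonal_paired[OF d])
    fix b assume b: "b < d"
    show "cmod (v (\<rho> b)) = 1" using v1 involution_onD(1)[OF \<rho> b] by simp
    show "v (\<rho> (flip b)) = cnj (v (\<rho> b))"
    proof (cases "even b")
      case True
      then show ?thesis using pair[of b] b by (simp add: flip_def)
    next
      case False
      then show ?thesis using pair[of "b - 1"] b by (simp add: flip_def)
    qed
  qed
  from realizable_conj_B[OF this inv_mat_unitary[OF \<rho>] at_block_carrier[OF dg_carrier]]
  have "realizable d 8 (blk d d (\<lambda>a. inv_mat d \<rho> * at_block d 0 (dg d (\<lambda>b. v (\<rho> b))) a * inv_mat d \<rho>))"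
    by (simp add: inv_mat_adjoint[OF \<rho>])
  also have "blk d d (\<lambda>a. inv_mat d \<rho> * at_block d 0 (dg d (\<lambda>b. v (\<rho> b))) a * inv_mat d \<rho>) =
      blk d d (at_block d 0 (dg d v))"
  proof (rule blk_cong)
    fix a :: nat
    have "dg d (\<lambda>b. v (\<rho> (\<rho> b))) = dg d v"
      by (rule dg_cong) (simp add: involution_onD(2)[OF \<rho>])
    then show "inv_mat d \<rho> * at_block d 0 (dg d (\<lambda>b. v (\<rho> b))) a * inv_mat d \<rho> = at_block d 0 (dg d v) a"
      by (simp add: at_block_def inv_mat_conj_dg[OF \<rho>] inv_mat_square[OF \<rho>]
          right_mult_one_mat[OF inv_mat_carrier])
  qed
  finally have v: "realizable d 8 (blk d d (at_block d 0 (dg d v)))" .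
  have "realizable d (8 + 8) (blk d d (\<lambda>a. at_block d 0 (dg d u) a * at_block d 0 (dg d v) a))"
    by (intro realizable_blk_mult u v at_block_carrier dg_carrier)
  also have "blk d d (\<lambda>a. at_block d 0 (dg d u) a * at_block d 0 (dg d v) a) =
      blk d d (at_block d 0 (dg d f))"
    by (rule blk_cong) (auto simp: at_block_def dg_mult uv intro!: dg_cong)
  finally show ?thesis by simp
qed

lemma unit_root_exists:
  assumes "cmod z = 1" "n > 0"
  obtains w where "w ^ n = z" "cmod w = 1"
proof
  show "cis (Arg z / n) ^ n = z"
    using assms cis_Arg[of z] by (cases "z = 0") (simp_all add: DeMoivre sgn_eq)
qed simp

text \<open>In an eigenbasis, which is a free change of basis on B, the eigenvalues are divided by a
  \<open>d\<close>-th root \<open>w\<close> of their product. The scalar \<open>w\<close> on one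
  block is a phase gate on A. A transposition of basis states of A finally moves block 0 to block
  \<open>i\<close>.\<close>

lemma realizable_at_block:
  assumes d: "even d" and W: "W \<in> unitary_group d" and i: "i < d"
  shows "realizable d 16 (blk d d (at_block d i W))"
proof -
  have d0: "d > 0" using i by simp
  obtain Q f where Q: "Q \<in> unitary_group d" and WQ: "W = Q * dg d f * mat_adjoint Q"
    using unitary_diagonalization[OF W] by blast
  note c = unitary_carrier[OF Q] unitary_carrier[OF W]
  note simps = assoc_mult_mat[where ?n\<^sub>1.0 = d and ?n\<^sub>2.0 = d and ?n\<^sub>3.0 = d and ?n\<^sub>4.0 = d]
    mult_carrier_mat[of _ d d]
  have "mat_adjoint Q * W * Q = dg d f"
    unfolding WQ using c by (simp add: simps unitary_adjoint_left[OF Q] mult_adjoint_cancel(2)[OF Q dg_carrier])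
  moreover have "mat_adjoint Q * W * Q \<in> unitary_group d"
    by (intro unitary_mult unitary_adjoint Q W)
  ultimately have f1: "cmod (f b) = 1" if "b < d" for b
    using dg_unitaryD[of d f b] that by simp
  have "cmod (\<Prod>b<d. f b) = 1" using f1 by (simp add: prod_norm[symmetric])
  then obtain w where w: "w ^ d = (\<Prod>b<d. f b)" "cmod w = 1"
    using unit_root_exists[OF _ d0] by blast
  have w0: "w \<noteq> 0" using w(2) by auto
  define f' where "f' b = f b / w" for b
  have "(\<Prod>b<d. f' b) = 1"
    unfolding f'_def prod_dividef using w0 by (simp flip: w(1))
  then have "realizable d 16 (blk d d (at_block d 0 (dg d f')))"
    by (intro realizable_diagonal_det_one d d0) (use f1 w in \<open>auto simp: f'_def norm_divide\<close>)
  from realizable_conj_B[OF this Q at_block_carrier[OF dg_carrier]]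
  have 1: "realizable d 16 (blk d d (\<lambda>a. Q * at_block d 0 (dg d f') a * mat_adjoint Q))" .
  have "realizable d 0 (tens d d (dg d (\<lambda>a. if a = 0 then w else 1)))"
    by (intro local_A dg_unitary) (use w in auto)
  then have 2: "realizable d 0 (blk d d (\<lambda>a. dg d (\<lambda>_. if a = 0 then w else 1)))"
    by (simp only: tens_dg)
  have "realizable d (0 + 16) (blk d d (\<lambda>a. dg d (\<lambda>_. if a = 0 then w else 1) *
      (Q * at_block d 0 (dg d f') a * mat_adjoint Q)))"
    by (intro realizable_blk_mult 1 2) (use c in \<open>auto intro!: mult_carrier_mat at_block_carrier\<close>)
  also have "blk d d (\<lambda>a. dg d (\<lambda>_. if a = 0 then w else 1) *
      (Q * at_block d 0 (dg d f') a * mat_adjoint Q)) = blk d d (at_block d 0 W)"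
  proof (rule blk_cong)
    fix a :: nat
    have comm: "dg d (\<lambda>_. w) * Q = Q * dg d (\<lambda>_. w)"
      by (rule eq_matI) (use c in \<open>auto simp: index_dg_mult[of _ d d] index_mult_dg[of _ d d]\<close>)
    have "dg d (\<lambda>_. w) * (Q * dg d f' * mat_adjoint Q) = (dg d (\<lambda>_. w) * Q) * dg d f' * mat_adjoint Q"
      using c by (simp add: simps)
    also have "\<dots> = Q * (dg d (\<lambda>_. w) * dg d f') * mat_adjoint Q"
      unfolding comm using c by (simp add: simps)
    also have "dg d (\<lambda>_. w) * dg d f' = dg d f"
      unfolding dg_mult by (rule dg_cong) (simp add: f'_def w0)
    finally have "dg d (\<lambda>_. w) * (Q * dg d f' * mat_adjoint Q) = W" using WQ by simp
    then show "dg d (\<lambda>_. if a = 0 then w else 1) * (Q * at_block d 0 (dg d f') a * mat_adjoint Q) =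
        at_block d 0 W a"
      using c by (auto simp: at_block_def dg_one unitary_adjoint_right[OF Q])
  qed
  finally have 3: "realizable d 16 (blk d d (at_block d 0 W))" by simp
  define \<tau> where "\<tau> a = (if a = 0 then i else if a = i then 0 else a)" for a
  have "involution_on d \<tau>" using i by (auto simp: involution_on_def \<tau>_def)
  from realizable_conj_A[OF 3 this] have "realizable d 16 (blk d d (\<lambda>a. at_block d 0 W (\<tau> a)))" .
  moreover have "(\<lambda>a. at_block d 0 W (\<tau> a)) = at_block d i W"
    by (auto simp: at_block_def \<tau>_def)
  ultimately show ?thesis by simp
qed

lemma realizable_one: "realizable d 0 (1\<^sub>m (d * d))"
  using local_B[OF unitary_one[of d]] by (simp add: blk_one)

text \<open>One factor for each of the \<open>d\<close> basis states of A, with 16 controlled-NOTs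
  per factor whatever the dimension.\<close>

lemma realizable_block_diagonal:
  assumes d: "even d" and f: "\<And>a. a < d \<Longrightarrow> f a \<in> unitary_group d"
  shows "realizable d (16 * d) (blk d d f)"
proof -
  have "realizable d (16 * n) (blk d d (\<lambda>a. if a < n then f a else 1\<^sub>m d))" if "n \<le> d" for n
    using that
  proof (induction n)
    case 0
    then show ?case using realizable_one by (simp add: blk_one)
  next
    case (Suc n)
    note fc = unitary_carrier[OF f]
    have "realizable d (16 * n + 16) (blk d d (\<lambda>a. (if a < n then f a else 1\<^sub>m d) * at_block d n (f n) a))"
      by (intro realizable_blk_mult realizable_at_block d f Suc.IH) (use Suc.prems fc in \<open>auto intro: at_block_carrier\<close>)
    also have "blk d d (\<lambda>a. (if a < n then f a else 1\<^sub>m d) * at_block d n (f n) a) =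
        blk d d (\<lambda>a. if a < Suc n then f a else 1\<^sub>m d)"
      by (rule blk_cong) (use Suc.prems in \<open>auto simp: at_block_def intro!: left_mult_one_mat[OF fc] right_mult_one_mat[OF fc]\<close>)
    finally show ?case by (simp add: algebra_simps)
  qed
  from this[of d] have "realizable d (16 * d) (blk d d (\<lambda>a. if a < d then f a else 1\<^sub>m d))" by simp
  also have "blk d d (\<lambda>a. if a < d then f a else 1\<^sub>m d) = blk d d f" by (rule blk_cong) simp
  finally show ?thesis .
qed

section \<open>The cosine-sine factor as a conjugate of a diagonal matrix\<close>

definition inv_sqrt2 :: complex where
  "inv_sqrt2 = of_real (1 / sqrt 2)"

definition hadamard :: "complex mat" where
  "hadamard = mat 2 2 (\<lambda>(i, j). if i = 1 \<and> j = 1 then - inv_sqrt2 else inv_sqrt2)"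

lemma inv_sqrt2_sq: "inv_sqrt2 * inv_sqrt2 = 1 / 2"
proof -
  have "inv_sqrt2 * inv_sqrt2 = of_real (1 / sqrt 2 * (1 / sqrt 2))"
    unfolding inv_sqrt2_def by (simp only: of_real_mult)
  also have "1 / sqrt 2 * (1 / sqrt 2) = 1 / (2::real)" by simp
  finally show ?thesis by simp
qed

lemma cnj_inv_sqrt2: "cnj inv_sqrt2 = inv_sqrt2"
  by (simp add: inv_sqrt2_def)

lemma hadamard_unitary: "hadamard \<in> unitary_group 2"
  unfolding unitary_entries
proof (intro conjI allI impI)
  fix i j :: nat assume ij: "i < 2" "j < 2"
  have "(\<Sum>k<2. cnj (hadamard $$ (k, i)) * hadamard $$ (k, j)) =
      cnj (hadamard $$ (0, i)) * hadamard $$ (0, j) + cnj (hadamard $$ (1, i)) * hadamard $$ (1, j)"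
    by (simp add: numeral_2_eq_2)
  also have "\<dots> = (if i = j then 1 else 0)"
    using ij by (auto simp: hadamard_def less_2_cases_iff cnj_inv_sqrt2 inv_sqrt2_sq)
  finally show "(\<Sum>k<2. cnj (hadamard $$ (k, i)) * hadamard $$ (k, j)) = (if i = j then 1 else 0)" .
qed (simp add: hadamard_def)

lemma tens_hadamard:
  "tens 2 m hadamard = four_block_mat (dg m (\<lambda>_. inv_sqrt2)) (dg m (\<lambda>_. inv_sqrt2))
     (dg m (\<lambda>_. inv_sqrt2)) (dg m (\<lambda>_. - inv_sqrt2))" (is "_ = ?H")
proof (rule eq_matI)
  fix i j assume "i < dim_row ?H" "j < dim_col ?H"
  then have ij: "i < 2 * m" "j < 2 * m" by auto
  have half: "k div m = (if k < m then 0 else 1)" "k mod m = (if k < m then k else k - m)" if "k < 2 * m" for k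
    using that by (auto simp: div_nat_eqI mod_if)
  show "tens 2 m hadamard $$ (i, j) = ?H $$ (i, j)"
    using ij by (auto simp: index_tens half hadamard_def)
qed auto

text \<open>For \<open>z = c + \<i> s\<close> the half sum and the half difference of
  \<open>z\<close> and its conjugate are \<open>c\<close> and \<open>\<i> s\<close>.\<close>

lemma cs_mat_eq:
  "cs_mat m c s = tens 2 m hadamard *
     dg (m + m) (\<lambda>i. if i < m then Complex (c i) (s i) else Complex (c (i - m)) (- s (i - m))) * tens 2 m hadamard"
proof -
  have e: "dg (m + m) (\<lambda>i. if i < m then Complex (c i) (s i) else Complex (c (i - m)) (- s (i - m))) =
      bdiag (dg m (\<lambda>i. Complex (c i) (s i))) (dg m (\<lambda>i. Complex (c i) (- s i)))"
    by (simp add: bdiag_dg)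
  let ?r = inv_sqrt2
  have r: "?r * x * ?r = x / 2" for x
    using inv_sqrt2_sq by (metis mult.commute mult.left_commute mult.right_neutral times_divide_eq_right)
  let ?e = "\<lambda>i. Complex (c i) (s i)" and ?e' = "\<lambda>i. Complex (c i) (- s i)"
  have 1: "four_block_mat (dg m (\<lambda>_. ?r)) (dg m (\<lambda>_. ?r)) (dg m (\<lambda>_. ?r)) (dg m (\<lambda>_. - ?r)) *
      four_block_mat (dg m ?e) (dg m (\<lambda>_. 0)) (dg m (\<lambda>_. 0)) (dg m ?e') =
      four_block_mat (dg m (\<lambda>i. ?r * ?e i)) (dg m (\<lambda>i. ?r * ?e' i)) (dg m (\<lambda>i. ?r * ?e i)) (dg m (\<lambda>i. - (?r * ?e' i)))"
    by (simp add: mult_four_block_mat[of _ m m _ m _ m _ _ m _ m] dg_mult dg_add)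
  have 2: "four_block_mat (dg m (\<lambda>i. ?r * ?e i)) (dg m (\<lambda>i. ?r * ?e' i)) (dg m (\<lambda>i. ?r * ?e i)) (dg m (\<lambda>i. - (?r * ?e' i))) *
      four_block_mat (dg m (\<lambda>_. ?r)) (dg m (\<lambda>_. ?r)) (dg m (\<lambda>_. ?r)) (dg m (\<lambda>_. - ?r)) =
      four_block_mat (dg m (\<lambda>i. ?e i / 2 + ?e' i / 2)) (dg m (\<lambda>i. ?e i / 2 - ?e' i / 2))
        (dg m (\<lambda>i. ?e i / 2 - ?e' i / 2)) (dg m (\<lambda>i. ?e i / 2 + ?e' i / 2))"
    by (simp add: mult_four_block_mat[of _ m m _ m _ m _ _ m _ m] dg_mult dg_add r)
  have 3: "?e i / 2 + ?e' i / 2 = of_real (c i)" "?e i / 2 - ?e' i / 2 = \<i> * of_real (s i)" for i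
    by (simp_all add: complex_eq_iff)
  show ?thesis
    unfolding e tens_hadamard cs_mat_def bdiag_def dim_dg dg_zero[symmetric] 1 2 3 ..
qed

text \<open>Associativity of the tensor product: with four digits of radices \<open>q\<close>,
  \<open>r\<close>, \<open>p\<close>, \<open>d\<close>, both sides apply \<open>V\<close> to the
  second digit. The left side exhibits a gate local to A, the right side a block diagonal operator
  with the block size of the current level.\<close>

lemma tens_blk_tens:
  "tens (q * (r * p)) d (blk q (r * p) (\<lambda>_. tens r p V)) = blk q (r * (p * d)) (\<lambda>_. tens r (p * d) V)"
  (is "?A = ?B")
proof (rule eq_matI)
  fix i j assume "i < dim_row ?B" "j < dim_col ?B"
  then have ij: "i < q * (r * (p * d))" "j < q * (r * (p * d))" by auto
  then have ij': "i < q * (r * p) * d" "j < q * (r * p) * d" by (auto simp: algebra_simps)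
  note dm = div_mod_less[OF ij(1)] div_mod_less[OF ij(2)] div_mod_less[OF ij'(1)] div_mod_less[OF ij'(2)]
  note dm' = div_mod_less[OF dm(5)] div_mod_less[OF dm(7)]
  have aux: "x mod (y * z) div z = x div z mod y" "x mod (y * z) mod z = x mod z" for x y z :: nat
    using mod_mult2_eq[of x z y] by (cases "z = 0"; simp add: mult.commute)+
  have e: "k div d div (r * p) = k div (r * (p * d))" for k
    by (metis div_mult2_eq mult.assoc mult.commute)
  have e1: "k div d mod (r * p) div p = k mod (r * (p * d)) div (p * d)" for k
    unfolding aux(1)[of k r "p * d"] aux(1)[of "k div d" r p]
    by (simp add: div_mult2_eq[symmetric] mult.commute)
  have e2: "k mod (r * (p * d)) mod (p * d) = d * (k div d mod p) + k mod d"
    "k div d mod (r * p) mod p = k div d mod p" for k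
    unfolding aux(2)[of k r "p * d"] aux(2)[of "k div d" r p]
    by (simp_all add: mult.commute[of p d] mod_mult2_eq)
  have "k mod d < d" if "k < q * (r * (p * d))" for k
    using that by (cases "d = 0") auto
  then have md: "i mod d < d" "j mod d < d" using ij by auto
  have e3: "d * x + i mod d = d * y + j mod d \<longleftrightarrow> i mod d = j mod d \<and> x = y" for x y
  proof
    assume a: "d * x + i mod d = d * y + j mod d"
    from arg_cong[OF this, of "\<lambda>k. k div d"] arg_cong[OF this, of "\<lambda>k. k mod d"] md
    show "i mod d = j mod d \<and> x = y" by simp
  qed simp
  show "?A $$ (i, j) = ?B $$ (i, j)"
    unfolding index_tens[OF ij'] index_blk[OF ij] index_blk[OF dm(5,7)] index_tens[OF dm'(2,4)]
      index_tens[OF dm(2,4)] e e1 e2 e3 by simp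
qed (auto simp: algebra_simps)

lemma realizable_hadamard:
  assumes "d = q * (2 * p)"
  shows "realizable d 0 (blk q (2 * (p * d)) (\<lambda>_. tens 2 (p * d) hadamard))"
proof -
  have "blk q (2 * p) (\<lambda>_. tens 2 p hadamard) \<in> unitary_group d"
    unfolding assms by (intro blk_unitary tens_unitary hadamard_unitary)
  from local_A[OF this] show ?thesis
    using tens_blk_tens[of q 2 p d hadamard] assms by simp
qed

text \<open>All \<open>q\<close> blocks are decomposed simultaneously. The left factors together
  form one operator with \<open>2 * q\<close> blocks of half the size, and so do the right ones,
  hence \<open>2 * c\<close>. The middle factors form one diagonal operator between two free
  Hadamard gates, hence \<open>16 * d\<close>.\<close>

lemma realizable_block_doubling:
  assumes d: "d = q * (2 * p)"
    and IH: "\<And>f. (\<And>a. a < 2 * q \<Longrightarrow> f a \<in> unitary_group (p * d)) \<Longrightarrow> realizable d c (blk (2 * q) (p * d) f)"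
    and f: "\<And>a. a < q \<Longrightarrow> f a \<in> unitary_group (2 * (p * d))"
  shows "realizable d (2 * c + 16 * d) (blk q (2 * (p * d)) f)"
proof -
  define m where "m = p * d"
  have "\<exists>z. a < q \<longrightarrow> (case z of (L1, L2, R1, R2, x, y) \<Rightarrow> L1 \<in> unitary_group m \<and> L2 \<in> unitary_group m \<and>
      R1 \<in> unitary_group m \<and> R2 \<in> unitary_group m \<and> (\<forall>i<m. (x i)\<^sup>2 + (y i)\<^sup>2 = (1::real)) \<and>
      f a = bdiag L1 L2 * cs_mat m x y * bdiag R1 R2)" for a
  proof (cases "a < q")
    case True
    then have "f a \<in> unitary_group (m + m)" using f unfolding m_def mult_2 by simp
    from cosine_sine_decomposition[OF this] obtain L1 L2 R1 R2 x y where
      "L1 \<in> unitary_group m" "L2 \<in> unitary_group m" "R1 \<in> unitary_group m" "R2 \<in> unitary_group m"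
      "\<And>i. i < m \<Longrightarrow> (x i)\<^sup>2 + (y i)\<^sup>2 = (1::real)"
      "f a = bdiag L1 L2 * cs_mat m x y * bdiag R1 R2"
      by blast
    then show ?thesis by (intro exI[of _ "(L1, L2, R1, R2, x, y)"]) simp
  qed simp
  then have "\<forall>a. \<exists>z. a < q \<longrightarrow> (case z of (L1, L2, R1, R2, x, y) \<Rightarrow> L1 \<in> unitary_group m \<and> L2 \<in> unitary_group m \<and>
      R1 \<in> unitary_group m \<and> R2 \<in> unitary_group m \<and> (\<forall>i<m. (x i)\<^sup>2 + (y i)\<^sup>2 = (1::real)) \<and>
      f a = bdiag L1 L2 * cs_mat m x y * bdiag R1 R2)" ..
  from choice[OF this] obtain z where z: "\<forall>a. a < q \<longrightarrow> (case z a of (L1, L2, R1, R2, x, y) \<Rightarrow> L1 \<in> unitary_group m \<and>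
      L2 \<in> unitary_group m \<and> R1 \<in> unitary_group m \<and> R2 \<in> unitary_group m \<and>
      (\<forall>i<m. (x i)\<^sup>2 + (y i)\<^sup>2 = (1::real)) \<and>
      f a = bdiag L1 L2 * cs_mat m x y * bdiag R1 R2)"
    by blast
  obtain L1 L2 R1 R2 x y where zeq: "\<And>a. z a = (L1 a, L2 a, R1 a, R2 a, x a, y a)"
    by (rule that[of "\<lambda>a. fst (z a)" "\<lambda>a. fst (snd (z a))" "\<lambda>a. fst (snd (snd (z a)))"
          "\<lambda>a. fst (snd (snd (snd (z a))))" "\<lambda>a. fst (snd (snd (snd (snd (z a)))))"
          "\<lambda>a. snd (snd (snd (snd (snd (z a)))))"]) simp
  have LR: "\<And>a. a < q \<Longrightarrow> L1 a \<in> unitary_group m" "\<And>a. a < q \<Longrightarrow> L2 a \<in> unitary_group m"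
      "\<And>a. a < q \<Longrightarrow> R1 a \<in> unitary_group m" "\<And>a. a < q \<Longrightarrow> R2 a \<in> unitary_group m"
    and xy: "\<And>a i. a < q \<Longrightarrow> i < m \<Longrightarrow> (x a i)\<^sup>2 + (y a i)\<^sup>2 = (1::real)"
    and fa: "\<And>a. a < q \<Longrightarrow> f a = bdiag (L1 a) (L2 a) * cs_mat m (x a) (y a) * bdiag (R1 a) (R2 a)"
    using z by (simp_all add: zeq)
  note LRc = LR[THEN unitary_carrier]
  define g where "g a i = (if i < m then Complex (x a i) (y a i) else Complex (x a (i - m)) (- y a (i - m)))"
    for a i
  have g1: "cmod (g a i) = 1" if "a < q" "i < m + m" for a i
    using xy[of a i] xy[of a "i - m"] that by (auto simp: g_def cmod_def)
  have bd: "realizable d c (blk q (m + m) (\<lambda>a. bdiag (S a) (T a)))"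
    if "\<And>a. a < q \<Longrightarrow> S a \<in> unitary_group m" "\<And>a. a < q \<Longrightarrow> T a \<in> unitary_group m" for S T
  proof -
    have "realizable d c (blk (2 * q) m (\<lambda>a. if even a then S (a div 2) else T (a div 2)))"
      unfolding m_def by (rule IH) (use that in \<open>auto simp: m_def\<close>)
    then show ?thesis
      using blk_bdiag[of q S m T] that[THEN unitary_carrier] by simp
  qed
  have qd: "q * (m + m) = d * d" unfolding m_def using d by (simp add: algebra_simps)
  \<comment> \<open>The \<open>q\<close> diagonal blocks are recut into \<open>d\<close> blocks of
    size \<open>d\<close>, so that the block diagonal case applies.\<close>
  have "blk q (m + m) (\<lambda>a. dg (m + m) (g a)) = dg (d * d) (\<lambda>i. g (i div (m + m)) (i mod (m + m)))"
    by (simp add: blk_dg qd)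
  also have "\<dots> = blk d d (\<lambda>a. dg d (\<lambda>b. g ((a * d + b) div (m + m)) ((a * d + b) mod (m + m))))"
    by (rule dg_blk)
  finally have dgb: "blk q (m + m) (\<lambda>a. dg (m + m) (g a)) =
    blk d d (\<lambda>a. dg d (\<lambda>b. g ((a * d + b) div (m + m)) ((a * d + b) mod (m + m))))" .
  have D: "realizable d (16 * d) (blk q (m + m) (\<lambda>a. dg (m + m) (g a)))"
    unfolding dgb
  proof (rule realizable_block_diagonal)
    show "even d" using d by simp
    fix a assume a: "a < d"
    show "dg d (\<lambda>b. g ((a * d + b) div (m + m)) ((a * d + b) mod (m + m))) \<in> unitary_group d"
    proof (rule dg_unitary)
      fix b assume "b < d"
      with a have "a * d + b < q * (m + m)"
        unfolding qd using mult_le_mono1[of "Suc a" d d] by simp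
      from div_mod_less[OF this]
      show "cmod (g ((a * d + b) div (m + m)) ((a * d + b) mod (m + m))) = 1" by (rule g1)
    qed
  qed
  have H: "realizable d 0 (blk q (m + m) (\<lambda>_. tens 2 m hadamard))"
    using realizable_hadamard[OF d] by (simp add: m_def mult_2)
  have Hc: "tens 2 m hadamard \<in> carrier_mat (m + m) (m + m)" using tens_carrier[of 2 m hadamard] by (simp add: mult_2)
  have K: "realizable d (16 * d) (blk q (m + m) (\<lambda>_. tens 2 m hadamard) * blk q (m + m) (\<lambda>a. dg (m + m) (g a)) *
      blk q (m + m) (\<lambda>_. tens 2 m hadamard))"
    by (intro realizable_mult0 H D)
  have "blk q (m + m) (\<lambda>_. tens 2 m hadamard) * blk q (m + m) (\<lambda>a. dg (m + m) (g a)) *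
      blk q (m + m) (\<lambda>_. tens 2 m hadamard) = blk q (m + m) (\<lambda>a. tens 2 m hadamard * dg (m + m) (g a) * tens 2 m hadamard)"
    using Hc by (simp add: blk_mult mult_carrier_mat[of _ "m + m" "m + m"])
  also have "\<dots> = blk q (m + m) (\<lambda>a. cs_mat m (x a) (y a))"
    unfolding cs_mat_eq g_def ..
  finally have K': "realizable d (16 * d) (blk q (m + m) (\<lambda>a. cs_mat m (x a) (y a)))" using K by simp
  have "realizable d (c + 16 * d + c) (blk q (m + m) (\<lambda>a. bdiag (L1 a) (L2 a)) *
      blk q (m + m) (\<lambda>a. cs_mat m (x a) (y a)) * blk q (m + m) (\<lambda>a. bdiag (R1 a) (R2 a)))"
    by (intro mult bd K' LR)
  also have "blk q (m + m) (\<lambda>a. bdiag (L1 a) (L2 a)) *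
      blk q (m + m) (\<lambda>a. cs_mat m (x a) (y a)) * blk q (m + m) (\<lambda>a. bdiag (R1 a) (R2 a)) =
      blk q (m + m) (\<lambda>a. bdiag (L1 a) (L2 a) * cs_mat m (x a) (y a) * bdiag (R1 a) (R2 a))"
  proof -
    have cc: "cs_mat m u v \<in> carrier_mat (m + m) (m + m)" for u v by (auto simp: cs_mat_def)
    have lc: "bdiag (L1 a) (L2 a) \<in> carrier_mat (m + m) (m + m)"
      "bdiag (R1 a) (R2 a) \<in> carrier_mat (m + m) (m + m)" if "a < q" for a
      using LRc that by (auto intro!: bdiag_carrier)
    show ?thesis
      using lc cc by (simp add: blk_mult mult_carrier_mat[of _ "m + m" "m + m"])
  qed
  also have "\<dots> = blk q (m + m) f" by (rule blk_cong) (simp add: fa)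
  finally have "realizable d (c + 16 * d + c) (blk q (m + m) f)" .
  moreover have "c + 16 * d + c = 2 * c + 16 * d" by simp
  ultimately show ?thesis by (simp only: m_def mult_2)
qed

text \<open>The lowest \<open>j\<close> qubits of A belong to the blocks, together with B, while the
  other \<open>k - j\<close> qubits act only as controls. The cost solves the recurrence given by
  the doubling step.\<close>

lemma realizable_blocks:
  assumes d: "d = 2 ^ k" "k \<ge> 1" and "j \<le> k"
    and "\<And>a. a < 2 ^ (k - j) \<Longrightarrow> f a \<in> unitary_group (2 ^ j * d)"
  shows "realizable d (16 * d * (2 ^ Suc j - 1)) (blk (2 ^ (k - j)) (2 ^ j * d) f)"
  using assms(3,4)
proof (induction j arbitrary: f)
  case 0
  have "even d" using d by simp
  with 0 show ?case using realizable_block_diagonal[of d f] d(1) by simp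
next
  case (Suc j)
  let ?q = "2 ^ (k - Suc j) :: nat"
  have q: "2 * ?q = 2 ^ (k - j)" using Suc.prems(1) by (simp add: Suc_diff_Suc flip: power_Suc)
  have dq: "d = ?q * (2 * 2 ^ j)"
    using Suc.prems(1) unfolding d(1) power_Suc[symmetric] power_add[symmetric] by simp
  have "realizable d (2 * (16 * d * (2 ^ Suc j - 1)) + 16 * d) (blk ?q (2 * (2 ^ j * d)) f)"
  proof (rule realizable_block_doubling[OF dq])
    fix f' assume "\<And>a. a < 2 * ?q \<Longrightarrow> f' a \<in> unitary_group (2 ^ j * d)"
    then show "realizable d (16 * d * (2 ^ Suc j - 1)) (blk (2 * ?q) (2 ^ j * d) f')"
      unfolding q by (intro Suc.IH) (use Suc.prems(1) in auto)
  next
    fix a assume "a < ?q"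
    then show "f a \<in> unitary_group (2 * (2 ^ j * d))" using Suc.prems(2)[of a] by (simp add: mult.assoc)
  qed
  moreover have "2 * (16 * d * (2 ^ Suc j - 1)) + 16 * d = 16 * d * (2 ^ Suc (Suc j) - 1)"
  proof -
    \<comment> \<open>Writing the power as a successor removes the truncated subtraction.\<close>
    obtain t :: nat where t: "2 ^ Suc j = Suc t" by (metis not0_implies_Suc power_not_zero zero_neq_numeral)
    have "2 ^ Suc (Suc j) = 2 * (2 ^ Suc j :: nat)" by simp
    then show ?thesis unfolding t by (simp add: algebra_simps)
  qed
  ultimately show ?case by (simp add: mult.assoc)
qed

text \<open>At level \<open>k\<close> there is a single block, so block diagonality restricts
  nothing. The constant comes from \<open>16 * d * 2 ^ Suc k = 32 * 4 ^ k\<close>.\<close>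

lemma realizable_unitary:
  assumes d: "d = 2 ^ k" "k \<ge> 1" and U: "U \<in> unitary_group (d * d)"
  obtains c where "realizable d c U" "c \<le> 32 * 4 ^ k"
proof -
  have "realizable d (16 * d * (2 ^ Suc k - 1)) (blk 1 (d * d) (\<lambda>_. U))"
    using realizable_blocks[OF d order_refl, of "\<lambda>_. U"] U d(1) by simp
  moreover have "blk 1 (d * d) (\<lambda>_. U) = U"
    using unitary_carrier[OF U] by (intro eq_matI) (auto simp: index_blk)
  moreover have "16 * d * (2 ^ Suc k - 1) \<le> 32 * 4 ^ k"
  proof -
    have "16 * d * (2 ^ Suc k - 1) \<le> 16 * d * 2 ^ Suc k" by simp
    also have "\<dots> = 32 * (2 ^ k * 2 ^ k)" unfolding d by simp
    also have "2 ^ k * 2 ^ k = (4 ^ k :: nat)" by (simp flip: power_mult_distrib)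
    finally show ?thesis .
  qed
  ultimately show ?thesis using that by auto
qed

subsection \<open>From operators to circuits\<close>

lemma nat_eq_iff_bits: "a = b \<longleftrightarrow> (\<forall>t. bit a t = bit (b :: nat) t)"
proof
  assume "\<forall>t. bit a t = bit b t"
  then show "a = b" by (intro bit_eqI) blast
qed simp

lemma bit_sub_index: "bit (sub_index qs i) t \<longleftrightarrow> t < length qs \<and> bit i (qs ! t)"
  unfolding sub_index_def bit_horner_sum_bit_iff by (cases "t < length qs") simp_all

lemma sub_index_less: "sub_index qs i < 2 ^ length qs"
  using horner_sum_of_bool_2_less[of "map (bit i) qs"] by (simp add: sub_index_def)

lemma sub_index_eq_iff: "sub_index qs i = sub_index qs j \<longleftrightarrow> (\<forall>r\<in>set qs. bit i r = bit j r)"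
proof -
  have "sub_index qs i = sub_index qs j \<longleftrightarrow> (\<forall>t. bit (sub_index qs i) t = bit (sub_index qs j) t)"
    by (rule nat_eq_iff_bits)
  also have "\<dots> \<longleftrightarrow> (\<forall>t<length qs. bit i (qs ! t) = bit j (qs ! t))"
    unfolding bit_sub_index by blast
  also have "\<dots> \<longleftrightarrow> (\<forall>r\<in>set qs. bit i r = bit j r)"
    by (simp add: all_set_conv_all_nth)
  finally show ?thesis .
qed

lemma odd_sub_index: "qs \<noteq> [] \<Longrightarrow> odd (sub_index qs i) \<longleftrightarrow> bit i (hd qs)"
  using bit_sub_index[of qs i 0] by (simp add: bit_0 hd_conv_nth)

lemma flip_eq_xor: "flip b = semiring_bit_operations_class.xor b 1"
  unfolding flip_def xor_one_eq by simp

text \<open>Bit 0 belongs to the first qubit of the list. This identifies the permutation matrix of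
  \<open>flip\<close> with the NOT on that qubit.\<close>

lemma sub_index_eq_flip_iff:
  assumes "qs \<noteq> []" "distinct qs"
  shows "sub_index qs i = flip (sub_index qs j) \<longleftrightarrow>
    bit i (hd qs) \<noteq> bit j (hd qs) \<and> (\<forall>r\<in>set qs - {hd qs}. bit i r = bit j r)"
proof -
  have "sub_index qs i = flip (sub_index qs j) \<longleftrightarrow>
      (\<forall>t. bit (sub_index qs i) t = bit (flip (sub_index qs j)) t)"
    by (rule nat_eq_iff_bits)
  also have "\<dots> \<longleftrightarrow> (\<forall>t<length qs. bit i (qs ! t) = (bit j (qs ! t) \<noteq> (t = 0)))"
  proof -
    have "bit (flip (sub_index qs j)) t \<longleftrightarrow> t < length qs \<and> (bit j (qs ! t) \<noteq> (t = 0))" for t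
      using assms(1) unfolding flip_eq_xor bit_xor_iff bit_sub_index bit_1_iff by (cases "t = 0") simp_all
    then show ?thesis unfolding bit_sub_index by blast
  qed
  also have "\<dots> \<longleftrightarrow> bit i (qs ! 0) \<noteq> bit j (qs ! 0) \<and> (\<forall>t<length qs. t \<noteq> 0 \<longrightarrow> bit i (qs ! t) = bit j (qs ! t))"
    (is "?L \<longleftrightarrow> ?R")
  proof
    have "0 < length qs" using assms(1) by simp
    moreover assume ?L
    ultimately have "bit i (qs ! 0) = (bit j (qs ! 0) \<noteq> (0 = (0::nat)))" by blast
    with \<open>?L\<close> show ?R by simp
  next
    assume R: ?R
    show ?L
    proof (intro allI impI)
      fix t assume "t < length qs"
      with R show "bit i (qs ! t) = (bit j (qs ! t) \<noteq> (t = 0))" by (cases "t = 0") simp_all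
    qed
  qed
  also have "(\<forall>t<length qs. t \<noteq> 0 \<longrightarrow> bit i (qs ! t) = bit j (qs ! t)) \<longleftrightarrow>
      (\<forall>r\<in>set qs - {hd qs}. bit i r = bit j r)"
  proof -
    have "set qs - {hd qs} = (!) qs ` {t. t < length qs \<and> t \<noteq> 0}"
    proof (intro equalityI subsetI)
      fix r assume "r \<in> set qs - {hd qs}"
      then obtain t where "t < length qs" "r = qs ! t" "r \<noteq> hd qs" by (auto simp: in_set_conv_nth)
      moreover from this have "t \<noteq> 0" using assms(1) by (metis hd_conv_nth)
      ultimately show "r \<in> (!) qs ` {t. t < length qs \<and> t \<noteq> 0}" by blast
    next
      fix r assume "r \<in> (!) qs ` {t. t < length qs \<and> t \<noteq> 0}"
      then obtain t where "t < length qs" "t \<noteq> 0" "r = qs ! t" by auto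
      then show "r \<in> set qs - {hd qs}"
        using assms by (simp add: hd_conv_nth nth_eq_iff_index_eq)
    qed
    then show ?thesis by auto
  qed
  finally show ?thesis using assms(1) by (simp add: hd_conv_nth)
qed

text \<open>Translates between the numbering \<open>a * d + b\<close> and that of the circuit model,
  where the qubits of A and B may alternate. For a bijection it is conjugation by a permutation
  matrix.\<close>

definition reindex :: "nat \<Rightarrow> (nat \<Rightarrow> nat) \<Rightarrow> complex mat \<Rightarrow> complex mat" where
  "reindex N \<phi> M = mat N N (\<lambda>(i, j). M $$ (\<phi> i, \<phi> j))"

lemma reindex_carrier [simp, intro]: "reindex N \<phi> M \<in> carrier_mat N N"
  by (simp add: reindex_def)

lemma reindex_mult:
  assumes \<phi>: "bij_betw \<phi> {..<N} {..<N}" and M: "M \<in> carrier_mat N N" and M': "M' \<in> carrier_mat N N"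
  shows "reindex N \<phi> (M * M') = reindex N \<phi> M * reindex N \<phi> M'"
proof (rule eq_matI)
  fix i j assume "i < dim_row (reindex N \<phi> M * reindex N \<phi> M')" "j < dim_col (reindex N \<phi> M * reindex N \<phi> M')"
  then have ij: "i < N" "j < N" by (auto simp: reindex_def)
  have lt: "\<phi> i < N" if "i < N" for i using bij_betwE[OF \<phi>] that by auto
  have "reindex N \<phi> (M * M') $$ (i, j) = (\<Sum>k<N. M $$ (\<phi> i, k) * M' $$ (k, \<phi> j))"
    using ij lt[OF ij(1)] lt[OF ij(2)] M M' by (simp add: reindex_def index_mult_mat_sum[OF M M'])
  also have "\<dots> = (\<Sum>k<N. M $$ (\<phi> i, \<phi> k) * M' $$ (\<phi> k, \<phi> j))"
    by (rule sum.reindex_bij_betw[OF \<phi>, symmetric])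
  also have "\<dots> = (reindex N \<phi> M * reindex N \<phi> M') $$ (i, j)"
    unfolding index_mult_mat_sum[OF reindex_carrier reindex_carrier ij]
    by (intro sum.cong refl) (use ij in \<open>simp add: reindex_def\<close>)
  finally show "reindex N \<phi> (M * M') $$ (i, j) = (reindex N \<phi> M * reindex N \<phi> M') $$ (i, j)" .
qed (auto simp: reindex_def)

lemma reindex_unitary:
  assumes \<phi>: "bij_betw \<phi> {..<N} {..<N}" and U: "U \<in> unitary_group N"
  shows "reindex N \<phi> U \<in> unitary_group N"
proof -
  note Uc = unitary_carrier[OF U]
  have lt: "\<phi> i < N" if "i < N" for i using bij_betwE[OF \<phi>] that by auto
  have "mat_adjoint (reindex N \<phi> U) = reindex N \<phi> (mat_adjoint U)"
  proof (rule eq_matI)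
    fix i j assume "i < dim_row (reindex N \<phi> (mat_adjoint U))" "j < dim_col (reindex N \<phi> (mat_adjoint U))"
    then have "i < N" "j < N" by (auto simp: reindex_def)
    with lt[of i] lt[of j] Uc
    show "mat_adjoint (reindex N \<phi> U) $$ (i, j) = reindex N \<phi> (mat_adjoint U) $$ (i, j)"
      by (simp add: reindex_def)
  qed (auto simp: reindex_def)
  then have "mat_adjoint (reindex N \<phi> U) * reindex N \<phi> U = reindex N \<phi> (1\<^sub>m N)"
    using reindex_mult[OF \<phi> mat_adjoint_carrier[OF Uc] Uc] by (simp add: unitary_adjoint_left[OF U])
  also have "\<dots> = 1\<^sub>m N"
  proof (rule eq_matI)
    fix i j assume "i < dim_row (1\<^sub>m N :: complex mat)" "j < dim_col (1\<^sub>m N :: complex mat)"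
    then have ij: "i < N" "j < N" by auto
    have "\<phi> i = \<phi> j \<longleftrightarrow> i = j"
      using ij by (intro inj_on_eq_iff[OF bij_betw_imp_inj_on[OF \<phi>]]) auto
    then show "reindex N \<phi> (1\<^sub>m N) $$ (i, j) = (1\<^sub>m N :: complex mat) $$ (i, j)"
      using ij lt[OF ij(1)] lt[OF ij(2)] by (simp add: reindex_def)
  qed (auto simp: reindex_def)
  finally show ?thesis by (simp add: unitary_group_def reindex_def)
qed

section \<open>Circuits and the controlled-NOT gate\<close>

lemma gate_op_carrier: "gate_op n g \<in> carrier_mat (2 ^ n) (2 ^ n)"
  by (simp add: gate_op_def)

lemma circuit_op_carrier: "circuit_op n c \<in> carrier_mat (2 ^ n) (2 ^ n)"
  by (induction c) (auto intro: mult_carrier_mat gate_op_carrier)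

lemma circuit_op_append: "circuit_op n (c @ c') = circuit_op n c' * circuit_op n c"
  by (induction c)
    (simp_all add: right_mult_one_mat[OF circuit_op_carrier]
      assoc_mult_mat[OF circuit_op_carrier circuit_op_carrier gate_op_carrier])

text \<open>The phase makes the determinant of the controlled-NOT equal to 1; it is undone by a local gate.\<close>

definition cx_gate :: "complex mat" where
  "cx_gate = dg 4 (\<lambda>_. cis (pi / 4)) * inv_mat 4 (\<lambda>c. if odd c then 4 - c else c)"

text \<open>On a qubit list \<open>[p, q]\<close> the odd indices 1 and 3 are those with
  \<open>p\<close> set; exchanging them by \<open>4 - c\<close> flips the bit of \<open>q\<close>.
  So \<open>p\<close> is the control and \<open>q\<close> the target.\<close>

lemma index_cx_gate:
  "r < 4 \<Longrightarrow> c < 4 \<Longrightarrow>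
     cx_gate $$ (r, c) = (if r = (if odd c then 4 - c else c) then cis (pi / 4) else 0)"
  by (simp add: cx_gate_def index_dg_mult[of _ 4 4] index_inv_mat)

text \<open>A transposition has determinant -1, and the phase contributes
  \<open>cis (pi / 4) ^ 4 = - 1\<close> in dimension 4.\<close>

lemma cx_gate_special_unitary: "cx_gate \<in> special_unitary_group 4"
proof -
  let ?\<sigma> = "\<lambda>c::nat. if odd c then 4 - c else c"
  have \<sigma>: "involution_on 4 ?\<sigma>"
    unfolding involution_on_def
  proof (intro allI impI)
    fix i :: nat assume "i < 4"
    then have "i \<in> {0, 1, 2, 3}" by auto
    then show "?\<sigma> i < 4 \<and> ?\<sigma> (?\<sigma> i) = i" by auto
  qed
  have "inv_mat 4 ?\<sigma> = swaprows_mat 4 1 3"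
  proof (rule eq_matI)
    fix i j assume "i < dim_row (swaprows_mat 4 1 3 :: complex mat)" "j < dim_col (swaprows_mat 4 1 3 :: complex mat)"
    then have "i \<in> {0,1,2,3}" "j \<in> {0,1,2,3}" by auto
    then show "inv_mat 4 ?\<sigma> $$ (i, j) = swaprows_mat 4 1 3 $$ (i, j)"
      by (auto simp: index_inv_mat)
  qed auto
  then have 1: "det (inv_mat 4 ?\<sigma>) = - 1" by (simp add: det_swaprows_mat)
  have "dg 4 (\<lambda>_. cis (pi / 4)) = cis (pi / 4) \<cdot>\<^sub>m 1\<^sub>m 4" by (rule eq_matI) auto
  then have "det (dg 4 (\<lambda>_. cis (pi / 4))) = cis (pi / 4) ^ 4" by simp
  also have "\<dots> = - 1" by (simp add: DeMoivre)
  finally have "det cx_gate = 1"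
    unfolding cx_gate_def by (simp add: det_mult[OF dg_carrier inv_mat_carrier] 1)
  moreover have "cx_gate \<in> unitary_group 4"
    unfolding cx_gate_def by (intro unitary_mult dg_unitary inv_mat_unitary \<sigma>) simp
  ultimately show ?thesis by (simp add: special_unitary_group_def)
qed

lemma realizable_carrier: "realizable d c M \<Longrightarrow> M \<in> carrier_mat (d * d) (d * d)"
  by (induction rule: realizable.induct) auto

text \<open>Quotient and remainder recover the two sub-indices and with them all bits below
  \<open>n\<close>; an injective map of a finite set into itself is bijective.\<close>

lemma bipartition_bij:
  assumes n: "n = length As + length Bs" and "distinct As" "distinct Bs" "set As \<union> set Bs = {..<n}"
  shows "bij_betw (\<lambda>i. sub_index As i * 2 ^ length Bs + sub_index Bs i) {..<2 ^ n} {..<2 ^ n}"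
proof -
  let ?\<phi> = "\<lambda>i. sub_index As i * 2 ^ length Bs + sub_index Bs i"
  have "?\<phi> i < 2 ^ n" for i
    using mult_le_mono1[of "Suc (sub_index As i)" "2 ^ length As" "2 ^ length Bs"]
      sub_index_less[of As i] sub_index_less[of Bs i] unfolding n power_add by simp
  then have "?\<phi> ` {..<2 ^ n} \<subseteq> {..<2 ^ n}" by auto
  moreover have "inj_on ?\<phi> {..<2 ^ n}"
  proof (rule inj_onI)
    fix i j :: nat assume ij: "i \<in> {..<2 ^ n}" "j \<in> {..<2 ^ n}" and eq: "?\<phi> i = ?\<phi> j"
    have "sub_index As i = sub_index As j" "sub_index Bs i = sub_index Bs j"
      using arg_cong[OF eq, of "\<lambda>k. k div 2 ^ length Bs"] arg_cong[OF eq, of "\<lambda>k. k mod 2 ^ length Bs"]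
        sub_index_less[of Bs] by simp_all
    then have "bit i r = bit j r" if "r < n" for r
      using that assms(4) unfolding sub_index_eq_iff by auto
    then have "take_bit n i = take_bit n j" by (intro bit_eqI) (auto simp: bit_take_bit_iff)
    then show "i = j" using ij by (simp add: take_bit_eq_mod)
  qed
  ultimately show ?thesis
    by (simp add: bij_betw_def endo_inj_surj)
qed

text \<open>Induction on the construction of \<open>M\<close>: each generator becomes a circuit of
  at most two gates, and products become concatenations.\<close>

lemma realizable_circuit:
  assumes "realizable d c M" and d: "d = 2 ^ k" "k \<ge> 1" and n: "n = 2 * k"
    and As: "distinct As" "length As = k" and Bs: "distinct Bs" "length Bs = k"
    and AB: "set As \<union> set Bs = {..<n}" "set As \<inter> set Bs = {}"
  shows "\<exists>circ. bipartite_circuit (set As) (set Bs) circ \<and>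
    circuit_op n circ = reindex (2 ^ n) (\<lambda>i. sub_index As i * d + sub_index Bs i) M \<and>
    straddling_count (set As) (set Bs) circ \<le> c"
proof -
  let ?A = "set As" and ?B = "set Bs" and ?N = "2 ^ n :: nat"
  define \<phi> where "\<phi> i = sub_index As i * d + sub_index Bs i" for i
  have N: "?N = d * d" unfolding n d(1) by (simp add: mult_2 power_add)
  have bij: "bij_betw \<phi> {..<?N} {..<?N}"
    using bipartition_bij[of n As Bs] As Bs AB n d(1) unfolding \<phi>_def by simp
  have lt: "\<phi> i < d * d" if "i < ?N" for i using bij_betwE[OF bij] that N by auto
  have less: "sub_index As i < d" "sub_index Bs i < d" for i
    using sub_index_less[of As i] sub_index_less[of Bs i] As Bs d by simp_all
  have \<phi>: "\<phi> i div d = sub_index As i" "\<phi> i mod d = sub_index Bs i" for i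
    using less[of i] by (simp_all add: \<phi>_def)
  have compl: "(\<forall>r<n. r \<notin> ?A \<longrightarrow> P r) \<longleftrightarrow> (\<forall>r\<in>?B. P r)" "(\<forall>r<n. r \<notin> ?B \<longrightarrow> P r) \<longleftrightarrow> (\<forall>r\<in>?A. P r)" for P
    using AB by blast+
  have gA: "circuit_op n [Gate As V] = reindex ?N \<phi> (tens d d V)" for V
  proof (rule eq_matI)
    fix i j assume "i < dim_row (reindex ?N \<phi> (tens d d V))" "j < dim_col (reindex ?N \<phi> (tens d d V))"
    then show "circuit_op n [Gate As V] $$ (i, j) = reindex ?N \<phi> (tens d d V) $$ (i, j)"
      by (simp add: left_mult_one_mat[OF gate_op_carrier] gate_op_def reindex_def index_tens lt \<phi>
          sub_index_eq_iff compl)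
  qed (auto simp: reindex_def gate_op_def)
  have gB: "circuit_op n [Gate Bs V] = reindex ?N \<phi> (blk d d (\<lambda>_. V))" for V
  proof (rule eq_matI)
    fix i j assume "i < dim_row (reindex ?N \<phi> (blk d d (\<lambda>_. V)))" "j < dim_col (reindex ?N \<phi> (blk d d (\<lambda>_. V)))"
    then show "circuit_op n [Gate Bs V] $$ (i, j) = reindex ?N \<phi> (blk d d (\<lambda>_. V)) $$ (i, j)"
      by (simp add: left_mult_one_mat[OF gate_op_carrier] gate_op_def reindex_def index_blk lt \<phi>
          sub_index_eq_iff compl)
  qed (auto simp: reindex_def gate_op_def)
  have ne: "As \<noteq> []" "Bs \<noteq> []" using As Bs d by auto
  \<comment> \<open>The first qubits of the two lists provide bit 0 of the digits \<open>a\<close>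
    and \<open>b\<close>. A control on \<open>p\<close> is thus the parity of \<open>a\<close>, and
    a NOT on \<open>q\<close> is \<open>flip\<close>.\<close>
  define p q where "p = hd As" and "q = hd Bs"
  have pq: "p \<in> ?A" "q \<in> ?B" using ne by (auto simp: p_def q_def)
  then have "p \<noteq> q" using AB(2) by auto
  have straddle: "straddling_gate ?A ?B (Gate [p, q] cx_gate)"
    using pq cx_gate_special_unitary by (auto simp: straddling_gate_def)
  have gX: "gate_op n (Gate [p, q] cx_gate) =
      reindex ?N \<phi> (blk d d (\<lambda>a. dg d (\<lambda>_. cis (pi / 4)) * cx_blk d a))" (is "_ = reindex _ _ ?X")
  proof (rule eq_matI)
    fix i j assume "i < dim_row (reindex ?N \<phi> ?X)" "j < dim_col (reindex ?N \<phi> ?X)"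
    then have ij: "i < ?N" "j < ?N" by (auto simp: reindex_def)
    let ?w = "cis (pi / 4)"
    \<comment> \<open>The two sides group the same conditions on bits differently: the gate
      separates \<open>p\<close> and \<open>q\<close> from all other qubits, the block form
      separates A from B.\<close>
    have comb: "(if P1 \<and> P2 \<and> C then w else 0) = (if A1 then w * (if C \<and> B1 then 1 else 0) else 0)"
      if "P1 \<and> P2 \<longleftrightarrow> A1 \<and> B1" for P1 P2 A1 B1 C and w :: complex
      using that by auto
    have s: "sub_index [p, q] l = of_bool (bit l p) + 2 * of_bool (bit l q)" for l
      by (simp add: sub_index_def)
    have "cx_gate $$ (sub_index [p, q] i, sub_index [p, q] j) =
        (if bit i p = bit j p \<and> (if bit i p then bit i q \<noteq> bit j q else bit i q = bit j q) then ?w else 0)"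
      unfolding s by (subst index_cx_gate) auto
    then have L: "gate_op n (Gate [p, q] cx_gate) $$ (i, j) =
        (if (\<forall>r<n. r \<noteq> p \<and> r \<noteq> q \<longrightarrow> bit i r = bit j r) \<and> bit i p = bit j p \<and>
          (if bit i p then bit i q \<noteq> bit j q else bit i q = bit j q) then ?w else 0)"
      using ij by (simp add: gate_op_def) blast
    have "(dg d (\<lambda>_. ?w) * cx_blk d a) $$ (x, y) = ?w * cx_blk d a $$ (x, y)" if "x < d" "y < d" for a x y
      by (rule index_dg_mult) (use that in \<open>auto simp: cx_blk_def\<close>)
    then have R: "reindex ?N \<phi> ?X $$ (i, j) = (if sub_index As i = sub_index As j then
        ?w * cx_blk d (sub_index As i) $$ (sub_index Bs i, sub_index Bs j) else 0)"
      using ij by (simp add: reindex_def index_blk lt \<phi> less)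
    have X: "cx_blk d (sub_index As i) $$ (sub_index Bs i, sub_index Bs j) =
        (if (if bit i p then bit i q \<noteq> bit j q else bit i q = bit j q) \<and> (\<forall>r\<in>?B - {q}. bit i r = bit j r)
         then 1 else 0)"
    proof (cases "bit i p")
      case True
      then have "odd (sub_index As i)" using odd_sub_index[OF ne(1), of i] by (simp add: p_def)
      then show ?thesis
        using True less by (simp add: cx_blk_def index_inv_mat sub_index_eq_flip_iff[OF ne(2) Bs(1)] q_def)
    next
      case False
      then have "even (sub_index As i)" using odd_sub_index[OF ne(1), of i] by (simp add: p_def)
      moreover have "(\<forall>r\<in>?B. bit i r = bit j r) \<longleftrightarrow> bit i q = bit j q \<and> (\<forall>r\<in>?B - {q}. bit i r = bit j r)"
        using pq(2) by auto
      ultimately show ?thesis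
        using False less by (simp add: cx_blk_def sub_index_eq_iff)
    qed
    have "(\<forall>r<n. r \<noteq> p \<and> r \<noteq> q \<longrightarrow> bit i r = bit j r) \<and> bit i p = bit j p \<longleftrightarrow>
        (\<forall>r\<in>?A. bit i r = bit j r) \<and> (\<forall>r\<in>?B - {q}. bit i r = bit j r)" (is "?L \<longleftrightarrow> ?R")
    proof
      assume L: ?L
      have "bit i r = bit j r" if "r \<in> ?A" for r
      proof -
        have "r < n" "r \<noteq> q" using that AB pq by auto
        then show ?thesis using L by metis
      qed
      moreover have "bit i r = bit j r" if "r \<in> ?B - {q}" for r
      proof -
        have "r < n" "r \<noteq> p" "r \<noteq> q" using that AB pq by auto
        then show ?thesis using L by blast
      qed
      ultimately show ?R by blast
    next
      assume R: ?R
      have "bit i r = bit j r" if "r < n" "r \<noteq> q" for r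
      proof -
        have "r \<in> ?A \<or> r \<in> ?B - {q}" using that AB(1) by auto
        then show ?thesis using R by blast
      qed
      then show ?L using R pq(1) by blast
    qed
    then show "gate_op n (Gate [p, q] cx_gate) $$ (i, j) = reindex ?N \<phi> ?X $$ (i, j)"
      unfolding L R X sub_index_eq_iff by (rule comb)
  qed (auto simp: reindex_def gate_op_def)
  \<comment> \<open>\<open>straddling_count\<close> tests the gates themselves, so a gate within A
    or within B must be shown not to pass the test, even if it acts on two qubits.\<close>
  have not_straddling: "\<not> straddling_gate ?A ?B (Gate As V)" "\<not> straddling_gate ?A ?B (Gate Bs V)" for V
    using AB(2) by (auto simp: straddling_gate_def)
  have localA: "local_gate ?A (Gate As V)" and localB: "local_gate ?B (Gate Bs V)" if "V \<in> unitary_group d" for V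
    using that As Bs d by (auto simp: local_gate_def)
  have "\<exists>circ. bipartite_circuit ?A ?B circ \<and> circuit_op n circ = reindex ?N \<phi> M \<and>
      straddling_count ?A ?B circ \<le> c"
    using assms(1)
  proof (induction rule: realizable.induct)
    case (local_A V)
    then show ?case
      by (intro exI[of _ "[Gate As V]"] conjI gA)
        (simp_all add: bipartite_circuit_def straddling_count_def localA not_straddling)
  next
    case (local_B V)
    then show ?case
      by (intro exI[of _ "[Gate Bs V]"] conjI gB)
        (simp_all add: bipartite_circuit_def straddling_count_def localB not_straddling)
  next
    case cx
    let ?P = "dg d (\<lambda>_. cis (- (pi / 4)))"
    have P: "?P \<in> unitary_group d" by (rule dg_unitary) simp
    let ?c = "[Gate [p, q] cx_gate, Gate As ?P]"
    have cc: "cx_blk d a \<in> carrier_mat d d" for a by (auto simp: cx_blk_def)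
    have "circuit_op n ?c = reindex ?N \<phi> (tens d d ?P) * reindex ?N \<phi> (blk d d (\<lambda>a. dg d (\<lambda>_. cis (pi / 4)) * cx_blk d a))"
      using gA[of ?P] by (simp add: gX)
    also have "\<dots> = reindex ?N \<phi> (tens d d ?P * blk d d (\<lambda>a. dg d (\<lambda>_. cis (pi / 4)) * cx_blk d a))"
      using N by (subst reindex_mult[OF bij]) auto
    also have "tens d d ?P * blk d d (\<lambda>a. dg d (\<lambda>_. cis (pi / 4)) * cx_blk d a) = blk d d (cx_blk d)"
    proof -
      have "?P * (dg d (\<lambda>_. cis (pi / 4)) * cx_blk d a) = cx_blk d a" for a
      proof -
        have "?P * (dg d (\<lambda>_. cis (pi / 4)) * cx_blk d a) = (?P * dg d (\<lambda>_. cis (pi / 4))) * cx_blk d a"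
          by (rule assoc_mult_mat[symmetric, OF dg_carrier dg_carrier cc])
        also have "?P * dg d (\<lambda>_. cis (pi / 4)) = 1\<^sub>m d" by (simp add: dg_mult cis_mult dg_one)
        finally show ?thesis by (simp only: left_mult_one_mat[OF cc])
      qed
      then show ?thesis
        unfolding tens_dg by (subst blk_mult) (auto intro!: mult_carrier_mat cc)
    qed
    finally have "circuit_op n ?c = reindex ?N \<phi> (blk d d (cx_blk d))" .
    then show ?case
      by (intro exI[of _ ?c])
        (simp add: bipartite_circuit_def straddling_count_def localA[OF P] not_straddling straddle)
  next
    case (mult c M c' M')
    then obtain C C' where C: "bipartite_circuit ?A ?B C" "circuit_op n C = reindex ?N \<phi> M"
      "straddling_count ?A ?B C \<le> c" and C': "bipartite_circuit ?A ?B C'"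
      "circuit_op n C' = reindex ?N \<phi> M'" "straddling_count ?A ?B C' \<le> c'"
      by blast
    \<comment> \<open>The right factor of the product acts first, so its circuit comes
      first.\<close>
    have "circuit_op n (C' @ C) = reindex ?N \<phi> (M * M')"
      unfolding circuit_op_append C(2) C'(2)
      by (rule reindex_mult[OF bij, symmetric])
        (use realizable_carrier[OF mult.hyps(1)] realizable_carrier[OF mult.hyps(2)] in \<open>simp_all only: N\<close>)
    with C C' show ?case
      by (intro exI[of _ "C' @ C"]) (auto simp: bipartite_circuit_def straddling_count_def)
  qed
  then show ?thesis unfolding \<phi>_def .
qed

theorem mainTheorem3:
  shows "\<exists>C::real. C > 0 \<and>
    (\<forall>(k\<^sub>1::nat) n A B U.
       k\<^sub>1 \<ge> 1 \<and> n = 2 * k\<^sub>1 \<and>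
       A \<union> B = {..<n} \<and> A \<inter> B = {} \<and> card A = k\<^sub>1 \<and> card B = k\<^sub>1 \<and>
       U \<in> unitary_group (2 ^ n) \<longrightarrow>
       (\<exists>c. bipartite_circuit A B c \<and> circuit_op n c = U \<and>
            real (straddling_count A B c) \<le> C * 4 ^ k\<^sub>1))"
proof (intro exI[of _ 32] conjI allI impI)
  fix k n :: nat and A B U
  assume "k \<ge> 1 \<and> n = 2 * k \<and> A \<union> B = {..<n} \<and> A \<inter> B = {} \<and> card A = k \<and> card B = k \<and>
    U \<in> unitary_group (2 ^ n)"
  then have k: "k \<ge> 1" and n: "n = 2 * k" and AB: "A \<union> B = {..<n}" "A \<inter> B = {}"
    and card: "card A = k" "card B = k" and U: "U \<in> unitary_group (2 ^ n)"
    by auto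
  define As Bs where "As = sorted_list_of_set A" and "Bs = sorted_list_of_set B"
  have "finite (A \<union> B)" unfolding AB(1) by simp
  then have fin: "finite A" "finite B" by auto
  have As: "distinct As" "length As = k" "set As = A" and Bs: "distinct Bs" "length Bs = k" "set Bs = B"
    using fin card by (simp_all add: As_def Bs_def)
  let ?d = "2 ^ k :: nat" and ?N = "2 ^ n :: nat"
  let ?\<phi> = "\<lambda>i. sub_index As i * ?d + sub_index Bs i"
  have N: "?N = ?d * ?d" unfolding n by (simp add: mult_2 power_add)
  have bij: "bij_betw ?\<phi> {..<?N} {..<?N}"
    using bipartition_bij[of n As Bs] As Bs AB n by simp
  \<comment> \<open>\<open>U\<close> is translated to the numbering by digits with the inverse
    relabelling, which the relabelling of the resulting circuit undoes.\<close>
  define \<psi> where "\<psi> = inv_into {..<?N} ?\<phi>"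
  have \<psi>: "bij_betw \<psi> {..<?N} {..<?N}" unfolding \<psi>_def by (rule bij_betw_inv_into[OF bij])
  have "reindex ?N \<psi> U \<in> unitary_group (?d * ?d)"
    using reindex_unitary[OF \<psi> U] N by simp
  then obtain c where c: "realizable ?d c (reindex ?N \<psi> U)" "c \<le> 32 * 4 ^ k"
    using realizable_unitary[OF refl k] by blast
  obtain circ where circ: "bipartite_circuit A B circ" "circuit_op n circ = reindex ?N ?\<phi> (reindex ?N \<psi> U)"
    "straddling_count A B circ \<le> c"
    using realizable_circuit[OF c(1) refl k n As(1,2) Bs(1,2)] As(3) Bs(3) AB by auto
  have "reindex ?N ?\<phi> (reindex ?N \<psi> U) = U"
  proof (rule eq_matI)
    fix i j assume "i < dim_row U" "j < dim_col U"
    then have ij: "i < ?N" "j < ?N" using unitary_carrier[OF U] by auto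
    have "?\<phi> l < ?N \<and> \<psi> (?\<phi> l) = l" if "l < ?N" for l
      using bij_betwE[OF bij] bij_betw_inv_into_left[OF bij] that by (auto simp: \<psi>_def)
    with ij show "reindex ?N ?\<phi> (reindex ?N \<psi> U) $$ (i, j) = U $$ (i, j)"
      by (simp add: reindex_def)
  qed (use unitary_carrier[OF U] in \<open>auto simp: reindex_def\<close>)
  moreover have "real (straddling_count A B circ) \<le> 32 * 4 ^ k"
  proof -
    have "straddling_count A B circ \<le> 32 * 4 ^ k" using circ(3) c(2) by linarith
    then have "real (straddling_count A B circ) \<le> real (32 * 4 ^ k)" by (simp only: of_nat_le_iff)
    then show ?thesis by simp
  qed
  ultimately show "\<exists>c. bipartite_circuit A B c \<and> circuit_op n c = U \<and>
      real (straddling_count A B c) \<le> 32 * 4 ^ k"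
    using circ by auto
qed simp

end
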